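(* Let $R$ be a unique factorization domain such that $R[[x_1,\ldots,x_r]]$ is a unique factorization domain for every $r\geq1$. Then $\mathcal F^f(\mathbb Q_+^*,R)$ is a unique factorization domain.
   Context: $\mathbb N^*$ is the multiplicative monoid of positive integers and $\mathbb Q_+^*$ the multiplicative group of positive rational numbers. $\mathcal F^f(\mathbb Q_+^*,R)$ is the set of functions $\alpha:\mathbb Q_+^*\to R$ for which there is $d\in\mathbb N^*$ such that for all $q\in\mathbb Q_+^*$, $\alpha(q)\ne0$ implies $dq\in\mathbb N^*$; it is a commutative ring with unity under pointwise addition and the product $(\alpha\cdot\beta)(q)=\sum_{q'q''=q}\alpha(q')\beta(q'')$ (a sum with finitely many nonzero terms). *)

theory Defs
  imports "HOL-Algebra.Ring_Divisibility" "HOL-Library.Multiset"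
begin

text \<open>
  The formal power series ring R[[x_0, ..., x_{r-1}]]. A monomial is the multiset of the indices of its
  variables: \<^term>\<open>{#}\<close> is the monomial 1, and \<open>+\<close> is multiplication of monomials. A series is
  an arbitrary family of coefficients indexed by the monomials.
\<close>

definition monomials :: "nat \<Rightarrow> nat multiset set"
  where "monomials r = {m. set_mset m \<subseteq> {..<r}}"

definition power_series_ring :: "('a, 'm) ring_scheme \<Rightarrow> nat \<Rightarrow> (nat multiset \<Rightarrow> 'a) ring"
  where "power_series_ring R r =
    \<lparr>carrier = monomials r \<rightarrow>\<^sub>E carrier R,
     mult = (\<lambda>f g. \<lambda>m\<in>monomials r.
       \<Oplus>\<^bsub>R\<^esub>p\<in>{p. fst p + snd p = m}. f (fst p) \<otimes>\<^bsub>R\<^esub> g (snd p)),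
     one = (\<lambda>m\<in>monomials r. if m = {#} then \<one>\<^bsub>R\<^esub> else \<zero>\<^bsub>R\<^esub>),
     zero = (\<lambda>m\<in>monomials r. \<zero>\<^bsub>R\<^esub>),
     add = (\<lambda>f g. \<lambda>m\<in>monomials r. f m \<oplus>\<^bsub>R\<^esub> g m)\<rparr>"

lemma finite_submonomials: "finite {a. a \<subseteq># m}"
proof (induction m)
  case empty
  then show ?case by simp
next
  case (add x m)
  have "{a. a \<subseteq># add_mset x m} \<subseteq> {a. a \<subseteq># m} \<union> add_mset x ` {a. a \<subseteq># m}"
  proof
    fix a assume a: "a \<in> {a. a \<subseteq># add_mset x m}"
    show "a \<in> {a. a \<subseteq># m} \<union> add_mset x ` {a. a \<subseteq># m}"
    proof (cases "x \<in># a")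
      case True
      then obtain b where "a = add_mset x b"
        by (metis multi_member_split)
      then show ?thesis using a by simp
    next
      case False
      then have "a \<subseteq># m"
        using a by (metis diff_single_trivial mem_Collect_eq subset_eq_diff_conv add_mset_add_single)
      then show ?thesis by simp
    qed
  qed
  then show ?case
    using add.IH by (meson finite_UnI finite_imageI finite_subset)
qed

lemma finite_monomial_decompositions:
  "finite {p :: nat multiset \<times> nat multiset. fst p + snd p = m}"
proof (rule finite_subset)
  show "{p. fst p + snd p = m} \<subseteq> {a. a \<subseteq># m} \<times> {a. a \<subseteq># m}"
    by auto
  show "finite ({a. a \<subseteq># m} \<times> {a. a \<subseteq># m})"
    by (simp add: finite_submonomials)
qed

definition pos_nats :: "rat set"
  where "pos_nats = {of_nat n | n :: nat. 0 < n}"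

definition pos_rats :: "rat set"
  where "pos_rats = {q. 0 < q}"

definition bounded_denom_functions :: "('a, 'm) ring_scheme \<Rightarrow> (rat \<Rightarrow> 'a) set"
  where "bounded_denom_functions R =
    {\<alpha> \<in> pos_rats \<rightarrow>\<^sub>E carrier R.
      \<exists>d\<in>pos_nats. \<forall>q\<in>pos_rats. \<alpha> q \<noteq> \<zero>\<^bsub>R\<^esub> \<longrightarrow> d * q \<in> pos_nats}"

text \<open>
  In the product, the sum ranges over the pairs at which neither factor vanishes: the set of all
  factorizations of \<open>q\<close> is infinite, and \<^const>\<open>finsum\<close> over an infinite set is \<open>0\<close> by convention.
\<close>

definition conv_support ::
    "('a, 'm) ring_scheme \<Rightarrow> (rat \<Rightarrow> 'a) \<Rightarrow> (rat \<Rightarrow> 'a) \<Rightarrow> rat \<Rightarrow> (rat \<times> rat) set"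
  where "conv_support R \<alpha> \<beta> q =
    {p \<in> pos_rats \<times> pos_rats. fst p * snd p = q \<and> \<alpha> (fst p) \<noteq> \<zero>\<^bsub>R\<^esub> \<and> \<beta> (snd p) \<noteq> \<zero>\<^bsub>R\<^esub>}"

definition bounded_denom_ring :: "('a, 'm) ring_scheme \<Rightarrow> (rat \<Rightarrow> 'a) ring"
  where "bounded_denom_ring R =
    \<lparr>carrier = bounded_denom_functions R,
     mult = (\<lambda>\<alpha> \<beta>. \<lambda>q\<in>pos_rats.
       \<Oplus>\<^bsub>R\<^esub>p\<in>conv_support R \<alpha> \<beta> q. \<alpha> (fst p) \<otimes>\<^bsub>R\<^esub> \<beta> (snd p)),
     one = (\<lambda>q\<in>pos_rats. if q = 1 then \<one>\<^bsub>R\<^esub> else \<zero>\<^bsub>R\<^esub>),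
     zero = (\<lambda>q\<in>pos_rats. \<zero>\<^bsub>R\<^esub>),
     add = (\<lambda>\<alpha> \<beta>. \<lambda>q\<in>pos_rats. \<alpha> q \<oplus>\<^bsub>R\<^esub> \<beta> q)\<rparr>"

lemma finite_conv_support:
  assumes "\<alpha> \<in> bounded_denom_functions R" and "\<beta> \<in> bounded_denom_functions R"
  shows "finite (conv_support R \<alpha> \<beta> q)"
proof -
  obtain d where d: "d \<in> pos_nats" "\<And>x. x \<in> pos_rats \<Longrightarrow> \<alpha> x \<noteq> \<zero>\<^bsub>R\<^esub> \<Longrightarrow> d * x \<in> pos_nats"
    using assms(1) unfolding bounded_denom_functions_def by blast
  obtain e where e: "e \<in> pos_nats" "\<And>x. x \<in> pos_rats \<Longrightarrow> \<beta> x \<noteq> \<zero>\<^bsub>R\<^esub> \<Longrightarrow> e * x \<in> pos_nats"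
    using assms(2) unfolding bounded_denom_functions_def by blast
  have pos: "0 < d" "0 < e"
    using d(1) e(1) by (auto simp: pos_nats_def)
  define N where "N = nat \<lfloor>d * e * q\<rfloor>"
  have "conv_support R \<alpha> \<beta> q \<subseteq> (\<lambda>(m, n). (of_nat m / d, of_nat n / e)) ` ({..N} \<times> {..N})"
  proof
    fix p assume p: "p \<in> conv_support R \<alpha> \<beta> q"
    then have "d * fst p \<in> pos_nats" "e * snd p \<in> pos_nats" and pq: "fst p * snd p = q"
      using d(2) e(2) by (auto simp: conv_support_def)
    then obtain m n :: nat where mn: "d * fst p = of_nat m" "0 < m" "e * snd p = of_nat n" "0 < n"
      by (auto simp: pos_nats_def)
    have "d * e * q = (d * fst p) * (e * snd p)"
      using pq by (simp add: algebra_simps)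
    then have "d * e * q = of_nat (m * n)"
      using mn by simp
    then have "N = m * n"
      unfolding N_def by (metis floor_of_nat nat_int)
    then have "m \<le> N" "n \<le> N"
      using mn by simp_all
    moreover have "p = (of_nat m / d, of_nat n / e)"
      using mn pos by (metis nonzero_mult_div_cancel_left order_less_irrefl prod.collapse)
    ultimately show "p \<in> (\<lambda>(m, n). (of_nat m / d, of_nat n / e)) ` ({..N} \<times> {..N})"
      by auto
  qed
  then show ?thesis
    by (rule finite_subset) simp
qed

end

theory Submission
  imports "HOL-Computational_Algebra.Primes" Defs "HOL-Algebra.Subrings"
begin

text \<open>
  Unique factorization of integers identifies the multiplicative monoid of the positive integers with the
  monoid of monomials in countably many variables, one for each prime number. Under this identification
  the arithmetic functions, that is, the functions supported on the positive integers, are the formal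
  power series in countably many variables over \<open>R\<close>. The proof has two steps.

  First, the ring of arithmetic functions is a factorial domain (\<open>functions_with_denom_1_factorial\<close>). This is
  the argument of Cashwell and Everett. The ring is the inverse limit of the power series rings in finitely
  many variables along the truncations that set the last variable to zero, and these truncations are
  surjective and reflect units. Truncation does not decrease the number of irreducible factors, so for a
  nonzero nonunit \<open>f\<close> the number of irreducible factors of its truncation to \<open>r\<close> variables is constant for
  large \<open>r\<close>. From then on irreducible divisors of the truncations lift along the tower
  (\<open>irred_divisor_lift\<close>) and have a limit \<open>p\<close> that divides \<open>f\<close>. The truncations of \<open>p\<close> to many variables are
  irreducible, hence prime, and therefore \<open>p\<close> is prime (\<open>prime_if_\<pi>_irreducible\<close>). So every nonzero nonunit
  has a prime divisor (\<open>prime_divisor_ex\<close>), and splitting off prime divisors stops because the number of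
  irreducible factors of a fixed nonzero truncation drops each time (\<open>factorial_domain_limit\<close>).

  Secondly, the indicator function of a positive integer is a unit of the ring of all functions with
  bounded denominators, and a product with it clears denominators. This ring is thus a ring of fractions of
  the ring of arithmetic functions, and a ring of fractions of a factorial domain is factorial
  (\<open>factorial_domain_localization\<close>).
\<close>

section \<open>Factorial domains via products of primes\<close>

text \<open>
  The products of a unit and finitely many primes. A cancellative commutative monoid is factorial if and
  only if these are all its elements; this form of unique factorization needs neither lists of factors
  nor their comparison up to order and associates, and it is the one used below.
\<close>

inductive_set prime_products :: "('a, 'b) monoid_scheme \<Rightarrow> 'a set" for G (structure)
  where unit: "u \<in> Units G \<Longrightarrow> u \<in> prime_products G"
  | prime_mult: "\<lbrakk>p \<in> carrier G; prime G p; a \<in> prime_products G\<rbrakk> \<Longrightarrow> p \<otimes> a \<in> prime_products G"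

lemma (in monoid) prime_products_closed:
  "a \<in> prime_products G \<Longrightarrow> a \<in> carrier G"
  by (induction rule: prime_products.induct) auto

lemma (in comm_monoid) prime_products_unit_mult:
  assumes "a \<in> prime_products G" "u \<in> Units G"
  shows "u \<otimes> a \<in> prime_products G"
  using assms
proof (induction rule: prime_products.induct)
  case (unit v)
  then show ?case by (simp add: prime_products.unit)
next
  case (prime_mult p a)
  then have "p \<otimes> (u \<otimes> a) \<in> prime_products G"
    by (simp add: prime_products.prime_mult)
  moreover have "p \<otimes> (u \<otimes> a) = u \<otimes> (p \<otimes> a)"
    using prime_mult by (intro m_lcomm) (auto intro: prime_products_closed)
  ultimately show ?case by simp
qed

lemma (in comm_monoid_cancel) prime_products_imp_factorial_monoid:
  assumes "carrier G \<subseteq> prime_products G"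
  shows "factorial_monoid G"
proof -
  have irreducible_prime: "prime G q" if q: "q \<in> carrier G" "irreducible G q" for q
  proof -
    have "q \<in> prime_products G" using assms q by blast
    then show ?thesis
    proof (cases rule: prime_products.cases)
      case unit
      then show ?thesis using q by (auto elim: irreducibleE)
    next
      case (prime_mult p a)
      have a: "a \<in> carrier G" using prime_mult prime_products_closed by blast
      have "p \<notin> Units G" using prime_mult by (auto elim: primeE)
      then have "a \<in> Units G"
        using q prime_mult a by (auto elim: irreducible_prodE)
      then have "p \<sim> q"
        using prime_mult a by (intro associated_sym[of q] associatedI2'[of q p a]) auto
      then show ?thesis
        using prime_cong prime_mult q by blast
    qed
  qed
  interpret primeness_condition_monoid G
    by unfold_locales (rule irreducible_prime)
  have "\<exists>fs. set fs \<subseteq> carrier G \<and> wfactors G fs a" if "a \<in> prime_products G" for a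
    using that
  proof (induction rule: prime_products.induct)
    case (unit u)
    then show ?case by (intro exI[of _ "[]"]) simp
  next
    case (prime_mult p a)
    then obtain fs where "set fs \<subseteq> carrier G" "wfactors G fs a" by blast
    with prime_mult have "set (p # fs) \<subseteq> carrier G" "wfactors G (p # fs) (p \<otimes> a)"
      by (auto intro!: wfactors_mult_single prime_irreducible prime_products_closed)
    then show ?case by blast
  qed
  then show ?thesis
    using assms by (intro factorial_monoidI wfactors_unique) blast+
qed

lemma (in factorial_monoid) factorcount_mult:
  assumes "a \<in> carrier G" "b \<in> carrier G"
  shows "factorcount G (a \<otimes> b) = factorcount G a + factorcount G b"
proof -
  obtain as bs where as: "set as \<subseteq> carrier G" "wfactors G as a"
    and bs: "set bs \<subseteq> carrier G" "wfactors G bs b"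
    using wfactors_exist assms by meson
  then have "factorcount G (a \<otimes> b) = length (as @ bs)"
    using assms by (intro factorcount_unique wfactors_mult) auto
  then show ?thesis
    using as bs assms by (simp add: factorcount_unique)
qed

lemma (in factorial_monoid) factorcount_irreducible:
  assumes "a \<in> carrier G" "irreducible G a"
  shows "factorcount G a = 1"
  using assms factorcount_unique[of "[a]" a] by (auto simp: wfactors_def)

lemma (in factorial_monoid) factorcount_eq_0_iff:
  assumes "a \<in> carrier G"
  shows "factorcount G a = 0 \<longleftrightarrow> a \<in> Units G"
proof
  assume "factorcount G a = 0"
  moreover obtain as where "set as \<subseteq> carrier G" "wfactors G as a"
    using wfactors_exist assms by meson
  ultimately have "\<one> \<sim> a"
    using assms by (auto simp: factorcount_unique wfactors_def)
  then show "a \<in> Units G"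
    using assms assoc_unit_l[of \<one> a] associated_sym assoc_unit_r by blast
next
  assume "a \<in> Units G"
  then show "factorcount G a = 0"
    using factorcount_unique[of "[]" a] assms by simp
qed

lemma (in factorial_monoid) irreducible_divisor_ex:
  assumes "a \<in> carrier G" "a \<notin> Units G"
  obtains p b where "p \<in> carrier G" "irreducible G p" "b \<in> carrier G" "a = p \<otimes> b"
proof -
  obtain fs where fs: "set fs \<subseteq> carrier G" "factors G fs a"
    using factors_exist assms by blast
  then obtain p gs where "fs = p # gs"
    using nunit_factors[OF assms(2) fs(2)] by (cases fs) auto
  with fs show thesis
    by (intro that[of p "foldr (\<otimes>) gs \<one>"]) (auto simp: factors_def intro: multlist_closed)
qed

lemma (in factorial_monoid) irreducible_if_factorcount_1:
  assumes "a \<in> carrier G" "factorcount G a = 1"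
  shows "irreducible G a"
proof -
  have "a \<notin> Units G" using assms factorcount_eq_0_iff[of a] by auto
  then obtain p b where pb: "p \<in> carrier G" "irreducible G p" "b \<in> carrier G" "a = p \<otimes> b"
    using irreducible_divisor_ex assms by blast
  then have "factorcount G b = 0"
    using assms factorcount_mult factorcount_irreducible by auto
  then show ?thesis
    using pb factorcount_eq_0_iff irreducible_prod_rI by simp
qed

lemma (in factorial_monoid) carrier_subset_prime_products:
  "carrier G \<subseteq> prime_products G"
proof
  fix a assume "a \<in> carrier G"
  then show "a \<in> prime_products G"
  proof (induction "factorcount G a" arbitrary: a rule: less_induct)
    case less
    show ?case
    proof (cases "a \<in> Units G")
      case True
      then show ?thesis by (rule prime_products.unit)
    next
      case False
      then obtain p b where pb: "p \<in> carrier G" "irreducible G p" "b \<in> carrier G" "a = p \<otimes> b"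
        using irreducible_divisor_ex less by blast
      then have "b \<in> prime_products G"
        using less factorcount_mult factorcount_irreducible by simp
      then show ?thesis
        using pb irreducible_prime by (simp add: prime_products.prime_mult)
    qed
  qed
qed

lemma (in domain) factorial_domain_iff_prime_products:
  "factorial_domain R \<longleftrightarrow> carrier R - {\<zero>} \<subseteq> prime_products (mult_of R)"
proof
  assume "factorial_domain R"
  then interpret M: factorial_monoid "mult_of R"
    by (rule factorial_domain.axioms(2))
  show "carrier R - {\<zero>} \<subseteq> prime_products (mult_of R)"
    using M.carrier_subset_prime_products by simp
next
  assume "carrier R - {\<zero>} \<subseteq> prime_products (mult_of R)"
  then have "factorial_monoid (mult_of R)"
    using mult_of.prime_products_imp_factorial_monoid by simp
  then show "factorial_domain R"
    by (simp add: factorial_domain_def domain_axioms)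
qed

text \<open>
  A ring of fractions of a factorial domain \<open>K\<close> is factorial. The hypothesis says that every element of
  \<open>R\<close> is a fraction of elements of \<open>K\<close> whose denominator is a unit of \<open>R\<close>. A prime of \<open>K\<close> either divides
  such a denominator, and then it becomes a unit of \<open>R\<close>, or it remains prime.
\<close>

lemma (in cring) factorial_domain_localization:
  assumes K: "subcring K R" and fact: "factorial_domain (R\<lparr>carrier := K\<rparr>)"
    and denom: "\<And>t. t \<in> carrier R \<Longrightarrow> \<exists>s \<in> K \<inter> Units R. s \<otimes> t \<in> K"
  shows "factorial_domain R"
proof -
  let ?K = "R\<lparr>carrier := K\<rparr>"
  interpret K: factorial_domain ?K by fact
  have sub: "K \<subseteq> carrier R" "\<And>x y. x \<in> K \<Longrightarrow> y \<in> K \<Longrightarrow> x \<otimes> y \<in> K"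
    using subcringE[OF K] by auto
  have Kint: "x = \<zero> \<or> y = \<zero>" if "x \<in> K" "y \<in> K" "x \<otimes> y = \<zero>" for x y
    using K.integral[of x y] that by simp
  have unit_mult_zero: "t = \<zero>" if "s \<in> Units R" "t \<in> carrier R" "s \<otimes> t = \<zero>" for s t
    using Units_l_cancel[of s t \<zero>] that by auto
  interpret domain R
  proof (unfold_locales)
    show "\<one> \<noteq> \<zero>" using K.one_not_zero by simp
  next
    fix a b assume ab: "a \<otimes> b = \<zero>" "a \<in> carrier R" "b \<in> carrier R"
    obtain s t where s: "s \<in> K" "s \<in> Units R" "s \<otimes> a \<in> K" and t: "t \<in> K" "t \<in> Units R" "t \<otimes> b \<in> K"
      using denom ab by blast
    have "(s \<otimes> a) \<otimes> (t \<otimes> b) = (s \<otimes> t) \<otimes> (a \<otimes> b)"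
      using s(2) t(2) ab(2,3) by (simp add: Units_closed m_ac)
    then have "(s \<otimes> a) \<otimes> (t \<otimes> b) = \<zero>"
      using ab s t sub(1) by (simp add: subset_eq)
    then have "s \<otimes> a = \<zero> \<or> t \<otimes> b = \<zero>"
      using Kint s t by blast
    then show "a = \<zero> \<or> b = \<zero>"
      using unit_mult_zero s t ab by blast
  qed
  have prime: "p \<in> Units R \<or> prime (mult_of R) p" if p: "p \<in> K - {\<zero>}" "prime (mult_of ?K) p" for p
  proof (cases "p \<in> Units R")
    case False
    have pR: "p \<in> carrier R" using p sub by auto
    have pdvd: "p divides\<^bsub>?K\<^esub> x \<or> p divides\<^bsub>?K\<^esub> y"
      if "x \<in> K" "y \<in> K" "p divides\<^bsub>?K\<^esub> (x \<otimes> y)" for x y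
    proof -
      have "prime ?K p" using p K.prime_eq_prime_mult[of p] by simp
      then show ?thesis using that by (simp add: prime_def)
    qed
    have dvd_scaled: "p divides x" if dvd: "p divides\<^bsub>?K\<^esub> (s \<otimes> x)" and that: "s \<in> Units R" "x \<in> carrier R" for s x
    proof -
      obtain k where k: "k \<in> K" "s \<otimes> x = p \<otimes> k"
        using dvd by (auto simp: factor_def)
      have "x = inv s \<otimes> (s \<otimes> x)"
        using that by (simp add: m_assoc[symmetric] Units_closed)
      also have "\<dots> = p \<otimes> (inv s \<otimes> k)"
        using k sub(1) pR that by (auto intro!: m_lcomm)
      finally show ?thesis
        using k sub(1) that by (intro dividesI[of "inv s \<otimes> k"]) auto
    qed
    have "prime R p"
    proof (rule primeI[OF False])
      fix a b assume ab: "a \<in> carrier R" "b \<in> carrier R" and "p divides a \<otimes> b"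
      then obtain c where c: "c \<in> carrier R" "a \<otimes> b = p \<otimes> c"
        by (auto simp: factor_def)
      obtain s where s: "s \<in> K" "s \<in> Units R" "s \<otimes> a \<in> K" using denom[of a] ab by auto
      obtain t where t: "t \<in> K" "t \<in> Units R" "t \<otimes> b \<in> K" using denom[of b] ab by auto
      obtain u where u: "u \<in> K" "u \<in> Units R" "u \<otimes> c \<in> K" using denom[of c] c by auto
      have carr: "s \<in> carrier R" "t \<in> carrier R" "u \<in> carrier R" using s t u sub(1) by auto
      \<comment> \<open>The relation \<open>a \<otimes> b = p \<otimes> c\<close> lives in \<open>R\<close>; clearing the denominators of all three of \<open>a\<close>, \<open>b\<close>, \<open>c\<close>
        moves it to \<open>K\<close>, at the price of a factor \<open>u\<close> on the left.\<close>
      have "(s \<otimes> a) \<otimes> ((t \<otimes> b) \<otimes> u) = (s \<otimes> t \<otimes> u) \<otimes> (a \<otimes> b)"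
        using carr ab by algebra
      also have "\<dots> = p \<otimes> (s \<otimes> t \<otimes> (u \<otimes> c))"
        unfolding c(2) using carr ab c(1) pR by algebra
      finally have "p divides\<^bsub>?K\<^esub> ((s \<otimes> a) \<otimes> ((t \<otimes> b) \<otimes> u))"
        using s t u sub(2) by (auto simp: factor_def)
      then consider "p divides\<^bsub>?K\<^esub> (s \<otimes> a)" | "p divides\<^bsub>?K\<^esub> (t \<otimes> b)" | "p divides\<^bsub>?K\<^esub> u"
        using pdvd s t u sub(2) by meson
      then show "p divides a \<or> p divides b"
      proof cases
        case 3
        then obtain k where "k \<in> K" "u = p \<otimes> k" by (auto simp: factor_def)
        then have "p \<in> Units R"
          using u(2) unit_factor[of p k] pR sub(1) by auto
        then show ?thesis using False by simp
      qed (use dvd_scaled s t ab in auto)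
    qed
    then show ?thesis using prime_eq_prime_mult pR by simp
  qed simp
  have Kpp: "a \<in> prime_products (mult_of R)" if "a \<in> prime_products (mult_of ?K)" for a
    using that
  proof (induction rule: prime_products.induct)
    case (unit u)
    then have "u \<in> Units ?K" by (simp only: K.Units_mult_eq_Units)
    then have "u \<in> Units R" using sub(1) by (auto simp: Units_def)
    then show ?case by (simp add: prime_products.unit)
  next
    case (prime_mult p a)
    then consider "p \<in> Units R" | "prime (mult_of R) p"
      using prime by force
    then show ?case
    proof cases
      case 1
      then show ?thesis
        using mult_of.prime_products_unit_mult prime_mult by simp
    next
      case 2
      have "p \<in> carrier R - {\<zero>}" using prime_mult(1) sub(1) by auto
      then show ?thesis
        using 2 prime_mult prime_products.prime_mult[of p "mult_of R" a] by simp
    qed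
  qed
  have "t \<in> prime_products (mult_of R)" if t: "t \<in> carrier R - {\<zero>}" for t
  proof -
    obtain s where s: "s \<in> K" "s \<in> Units R" "s \<otimes> t \<in> K" using denom t by blast
    then have "s \<otimes> t \<noteq> \<zero>" using unit_mult_zero t by blast
    then have "s \<otimes> t \<in> prime_products (mult_of R)"
      using s K.factorial_domain_iff_prime_products fact Kpp by auto
    then have "inv s \<otimes> (s \<otimes> t) \<in> prime_products (mult_of R)"
      using s mult_of.prime_products_unit_mult[of "s \<otimes> t" "inv s"] by simp
    moreover have "inv s \<otimes> (s \<otimes> t) = t"
      using s t by (simp add: m_assoc[symmetric] Units_closed)
    ultimately show ?thesis by simp
  qed
  then show ?thesis
    using factorial_domain_iff_prime_products by blast
qed

section \<open>Limits of towers of factorial domains\<close>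

text \<open>
  The ring \<open>A\<close> is the inverse limit, with projections \<open>\<pi> r\<close>, of factorial domains \<open>B r\<close> along surjective
  ring homomorphisms \<open>\<rho> r\<close> from \<open>B (Suc r)\<close> to \<open>B r\<close> that reflect units. The limit property is stated for
  sequences that are only given, and only compatible, from some index \<open>N\<close> on, since this is how they arise.
\<close>

locale local_factorial_tower = cring A for A :: "('a, 'c) ring_scheme" (structure) +
  fixes B :: "nat \<Rightarrow> ('b, 'd) ring_scheme"
    and \<pi> :: "nat \<Rightarrow> 'a \<Rightarrow> 'b"
    and \<rho> :: "nat \<Rightarrow> 'b \<Rightarrow> 'b"
  assumes factorial: "factorial_domain (B r)"
    and \<pi>_hom: "\<pi> r \<in> ring_hom A (B r)"
    and \<rho>_hom: "\<rho> r \<in> ring_hom (B (Suc r)) (B r)"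
    and \<rho>_\<pi>: "x \<in> carrier A \<Longrightarrow> \<rho> r (\<pi> (Suc r) x) = \<pi> r x"
    and \<rho>_surj: "v \<in> carrier (B r) \<Longrightarrow> \<exists>u\<in>carrier (B (Suc r)). \<rho> r u = v"
    and \<rho>_local: "\<lbrakk>u \<in> carrier (B (Suc r)); \<rho> r u \<in> Units (B r)\<rbrakk> \<Longrightarrow> u \<in> Units (B (Suc r))"
    and limit: "\<lbrakk>\<And>r. N \<le> r \<Longrightarrow> c r \<in> carrier (B r); \<And>r. N \<le> r \<Longrightarrow> \<rho> r (c (Suc r)) = c r\<rbrakk>
      \<Longrightarrow> \<exists>x\<in>carrier A. \<forall>r\<ge>N. \<pi> r x = c r"
    and joint_inj: "\<lbrakk>x \<in> carrier A; y \<in> carrier A; \<And>r. \<pi> r x = \<pi> r y\<rbrakk> \<Longrightarrow> x = y"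
begin

sublocale B: domain "B r" for r
  by (rule factorial_domain.axioms(1)[OF factorial])

sublocale BM: factorial_monoid "mult_of (B r)"
  rewrites "mult (mult_of (B r)) = mult (B r)"
    and "one (mult_of (B r)) = one (B r)" for r
  by (simp_all add: factorial_domain.axioms(2)[OF factorial])

sublocale pi: ring_hom_cring A "B r" "\<pi> r" for r
  by (intro ring_hom_cring.intro ring_hom_cring_axioms.intro \<pi>_hom is_cring B.is_cring)

sublocale rho: ring_hom_cring "B (Suc r)" "B r" "\<rho> r" for r
  by (intro ring_hom_cring.intro ring_hom_cring_axioms.intro \<rho>_hom B.is_cring)

text \<open>The number of irreducible factors, counted with multiplicity, of a nonzero element of \<open>B r\<close>.\<close>

abbreviation \<Omega> :: "nat \<Rightarrow> 'b \<Rightarrow> nat"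
  where "\<Omega> r \<equiv> factorcount (mult_of (B r))"

text \<open>
  Being nonzero is part of this notion, because the library predicate \<^const>\<open>irreducible\<close> holds for the zero
  of the ring when it is applied to the monoid of nonzero elements.
\<close>

abbreviation irred :: "nat \<Rightarrow> 'b \<Rightarrow> bool"
  where "irred r x \<equiv> x \<in> carrier (B r) - {\<zero>\<^bsub>B r\<^esub>} \<and> irreducible (mult_of (B r)) x"

lemma \<pi>_eq_downward:
  assumes "\<pi> s x = \<pi> s y" "r \<le> s" "x \<in> carrier A" "y \<in> carrier A"
  shows "\<pi> r x = \<pi> r y"
  using assms(2)
proof (induction rule: inc_induct)
  case base
  then show ?case by (rule assms)
next
  case (step n)
  then show ?case using \<rho>_\<pi> assms by metis
qed

lemma eventually_\<pi>_eq_imp_eq: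
  assumes "\<And>s. N \<le> s \<Longrightarrow> \<pi> s x = \<pi> s y" "x \<in> carrier A" "y \<in> carrier A"
  shows "x = y"
proof (rule joint_inj[OF assms(2,3)])
  fix r
  show "\<pi> r x = \<pi> r y"
    using \<pi>_eq_downward[of "max N r" x y r] assms by simp
qed

lemma \<pi>_nonzero_upward:
  assumes "\<pi> r x \<noteq> \<zero>\<^bsub>B r\<^esub>" "r \<le> s" "x \<in> carrier A"
  shows "\<pi> s x \<noteq> \<zero>\<^bsub>B s\<^esub>"
  using \<pi>_eq_downward[of s x \<zero> r] assms by auto

lemma \<pi>_nonzero_ex:
  assumes "x \<in> carrier A" "x \<noteq> \<zero>"
  obtains r where "\<pi> r x \<noteq> \<zero>\<^bsub>B r\<^esub>"
  using joint_inj[of x \<zero>] assms by auto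

lemma \<pi>_Units_upward:
  assumes "\<pi> r x \<in> Units (B r)" "r \<le> s" "x \<in> carrier A"
  shows "\<pi> s x \<in> Units (B s)"
  using assms(2)
proof (induction rule: dec_induct)
  case base
  then show ?case by (rule assms)
next
  case (step n)
  then show ?case using \<rho>_\<pi> assms by (intro \<rho>_local) auto
qed

lemma \<pi>_divides_downward:
  assumes "\<pi> s f divides\<^bsub>B s\<^esub> \<pi> s g" "r \<le> s" "f \<in> carrier A" "g \<in> carrier A"
  shows "\<pi> r f divides\<^bsub>B r\<^esub> \<pi> r g"
  using assms(2)
proof (induction rule: inc_induct)
  case base
  then show ?case by (rule assms)
next
  case (step n)
  then obtain c where c: "c \<in> carrier (B (Suc n))" "\<pi> (Suc n) g = \<pi> (Suc n) f \<otimes>\<^bsub>B (Suc n)\<^esub> c"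
    by (auto simp: factor_def)
  then have "\<rho> n (\<pi> (Suc n) g) = \<rho> n (\<pi> (Suc n) f) \<otimes>\<^bsub>B n\<^esub> \<rho> n c"
    using assms by simp
  then have "\<pi> n g = \<pi> n f \<otimes>\<^bsub>B n\<^esub> \<rho> n c"
    by (simp only: \<rho>_\<pi>[OF assms(3)] \<rho>_\<pi>[OF assms(4)])
  then show ?case
    using c by (intro dividesI[of "\<rho> n c"]) simp
qed

text \<open>
  Divisibility in the limit can be tested at the levels beyond any level where the divisor is nonzero:
  there the quotients are unique, hence compatible.
\<close>

lemma divides_if_\<pi>_divides:
  assumes f: "f \<in> carrier A" "\<pi> N f \<noteq> \<zero>\<^bsub>B N\<^esub>" and g: "g \<in> carrier A"
    and dvd: "\<And>s. N \<le> s \<Longrightarrow> \<pi> s f divides\<^bsub>B s\<^esub> \<pi> s g"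
  shows "f divides g"
proof -
  have "\<forall>s. \<exists>c. N \<le> s \<longrightarrow> c \<in> carrier (B s) \<and> \<pi> s g = \<pi> s f \<otimes>\<^bsub>B s\<^esub> c"
    using dvd unfolding factor_def by blast
  then obtain c where c: "\<And>s. N \<le> s \<Longrightarrow> c s \<in> carrier (B s)"
      "\<And>s. N \<le> s \<Longrightarrow> \<pi> s g = \<pi> s f \<otimes>\<^bsub>B s\<^esub> c s"
    by metis
  have "\<rho> s (c (Suc s)) = c s" if s: "N \<le> s" for s
  proof -
    have "\<rho> s (\<pi> (Suc s) g) = \<rho> s (\<pi> (Suc s) f) \<otimes>\<^bsub>B s\<^esub> \<rho> s (c (Suc s))"
      using c[of "Suc s"] f s by simp
    then have "\<pi> s f \<otimes>\<^bsub>B s\<^esub> c s = \<pi> s f \<otimes>\<^bsub>B s\<^esub> \<rho> s (c (Suc s))"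
      using c(2)[OF s] f g \<rho>_\<pi> by simp
    moreover have "\<pi> s f \<noteq> \<zero>\<^bsub>B s\<^esub>" using \<pi>_nonzero_upward f s by blast
    ultimately show ?thesis
      using c(1)[of s] c(1)[of "Suc s"] f s by (simp add: B.m_lcancel)
  qed
  then obtain h where h: "h \<in> carrier A" "\<And>s. N \<le> s \<Longrightarrow> \<pi> s h = c s"
    using limit[of N c] c(1) by blast
  have "g = f \<otimes> h"
    using c(2) h f g by (intro eventually_\<pi>_eq_imp_eq[of N]) auto
  then show ?thesis using h by (auto intro: dividesI)
qed

lemma Units_if_\<pi>_Units:
  assumes "x \<in> carrier A" "\<pi> r x \<in> Units (B r)"
  shows "x \<in> Units A"
proof -
  have "\<pi> r x \<noteq> \<zero>\<^bsub>B r\<^esub>" using assms(2) B.Units_r_inv_ex[where x="\<pi> r x" and r=r] by auto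
  moreover have "\<pi> s x divides\<^bsub>B s\<^esub> \<pi> s \<one>" if "r \<le> s" for s
    using \<pi>_Units_upward[OF assms(2) that] assms(1) by (auto intro: B.unit_divides)
  ultimately have "x divides \<one>"
    using assms by (intro divides_if_\<pi>_divides[of _ r]) auto
  then show ?thesis using divides_one assms by blast
qed

text \<open>
  If \<open>p\<close> divides \<open>a \<otimes> b\<close>, then at each high level \<open>\<pi> s p\<close> divides one of the two factors. As divisibility
  descends from a level to the lower ones, the same factor can be chosen at all high levels.
\<close>

lemma prime_if_\<pi>_irreducible:
  assumes p: "p \<in> carrier A" and irr: "\<And>s. N \<le> s \<Longrightarrow> irred s (\<pi> s p)"
  shows "prime A p"
proof (rule primeI)
  have nonzero: "\<pi> s p \<noteq> \<zero>\<^bsub>B s\<^esub>" if "N \<le> s" for s using irr that by simp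
  show "p \<notin> Units A"
  proof
    assume "p \<in> Units A"
    then have "\<pi> N p divides\<^bsub>B N\<^esub> \<pi> N \<one>"
      using Units_r_inv_ex[of p] p pi.hom_mult by (metis pi.hom_closed dividesI)
    then have "\<pi> N p \<in> Units (B N)"
      using B.divides_one p by auto
    then show False using irr[of N] by (auto simp: irreducible_def)
  qed
  fix a b assume a: "a \<in> carrier A" and b: "b \<in> carrier A" and dvd: "p divides a \<otimes> b"
  then obtain c where c: "c \<in> carrier A" "a \<otimes> b = p \<otimes> c" by (auto simp: factor_def)
  have split: "\<pi> s p divides\<^bsub>B s\<^esub> \<pi> s a \<or> \<pi> s p divides\<^bsub>B s\<^esub> \<pi> s b" if s: "N \<le> s" for s
  proof -
    have "prime (mult_of (B s)) (\<pi> s p)"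
      using irr[OF s] by (intro BM.irreducible_prime) auto
    then have "prime (B s) (\<pi> s p)"
      using B.prime_eq_prime_mult p by simp
    moreover have "\<pi> s a \<otimes>\<^bsub>B s\<^esub> \<pi> s b = \<pi> s p \<otimes>\<^bsub>B s\<^esub> \<pi> s c"
      using c a b p by (metis pi.hom_mult)
    then have "\<pi> s p divides\<^bsub>B s\<^esub> \<pi> s a \<otimes>\<^bsub>B s\<^esub> \<pi> s b"
      using c by (intro dividesI[of "\<pi> s c"]) simp_all
    ultimately show ?thesis
      using a b by (simp add: prime_def)
  qed
  show "p divides a \<or> p divides b"
  proof (cases "\<forall>s\<ge>N. \<pi> s p divides\<^bsub>B s\<^esub> \<pi> s a")
    case True
    then show ?thesis using divides_if_\<pi>_divides[of p N a] a p nonzero by auto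
  next
    case False
    then obtain t where t: "N \<le> t" "\<not> \<pi> t p divides\<^bsub>B t\<^esub> \<pi> t a" by blast
    then have "\<pi> s p divides\<^bsub>B s\<^esub> \<pi> s b" if "t \<le> s" for s
      using split[of s] \<pi>_divides_downward[of s p a t] that a p by auto
    then show ?thesis using divides_if_\<pi>_divides[of p t b] b p nonzero t by auto
  qed
qed

sublocale A: domain A
proof unfold_locales
  show "\<one> \<noteq> \<zero>"
    using pi.hom_one[of 0] pi.hom_zero[of 0] B.one_not_zero[of 0] by metis
next
  fix a b assume ab: "a \<otimes> b = \<zero>" "a \<in> carrier A" "b \<in> carrier A"
  show "a = \<zero> \<or> b = \<zero>"
  proof (rule ccontr)
    assume "\<not> ?thesis"
    then obtain r s where "\<pi> r a \<noteq> \<zero>\<^bsub>B r\<^esub>" "\<pi> s b \<noteq> \<zero>\<^bsub>B s\<^esub>"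
      using \<pi>_nonzero_ex ab by metis
    then have "\<pi> (max r s) a \<noteq> \<zero>\<^bsub>B (max r s)\<^esub>" "\<pi> (max r s) b \<noteq> \<zero>\<^bsub>B (max r s)\<^esub>"
      using \<pi>_nonzero_upward ab by (meson max.cobounded1 max.cobounded2)+
    moreover have "\<pi> (max r s) a \<otimes>\<^bsub>B (max r s)\<^esub> \<pi> (max r s) b = \<zero>\<^bsub>B (max r s)\<^esub>"
      using ab pi.hom_mult[of a b] by simp
    ultimately show False
      using B.integral ab by (meson pi.hom_closed)
  qed
qed

lemma \<Omega>_mult:
  assumes "x \<in> carrier (B r) - {\<zero>\<^bsub>B r\<^esub>}" "y \<in> carrier (B r) - {\<zero>\<^bsub>B r\<^esub>}"
  shows "\<Omega> r (x \<otimes>\<^bsub>B r\<^esub> y) = \<Omega> r x + \<Omega> r y"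
  using BM.factorcount_mult assms by simp

lemma \<Omega>_irred: "irred r x \<Longrightarrow> \<Omega> r x = 1"
  using BM.factorcount_irreducible by simp

lemma \<Omega>_pos:
  assumes "x \<in> carrier (B r) - {\<zero>\<^bsub>B r\<^esub>}" "x \<notin> Units (B r)"
  shows "\<Omega> r x \<ge> 1"
  using BM.factorcount_eq_0_iff[where a=x and r=r] assms by (simp add: Suc_le_eq)

lemma irred_divisor_ex:
  assumes "x \<in> carrier (B r) - {\<zero>\<^bsub>B r\<^esub>}" "x \<notin> Units (B r)"
  obtains p y where "irred r p" "y \<in> carrier (B r) - {\<zero>\<^bsub>B r\<^esub>}" "x = p \<otimes>\<^bsub>B r\<^esub> y"
proof -
  have "x \<in> carrier (mult_of (B r))" "x \<notin> Units (mult_of (B r))" using assms by simp_all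
  then obtain p y where "p \<in> carrier (mult_of (B r))" "irreducible (mult_of (B r)) p"
      "y \<in> carrier (mult_of (B r))" "x = p \<otimes>\<^bsub>B r\<^esub> y"
    by (rule BM.irreducible_divisor_ex)
  then show thesis by (intro that) simp_all
qed

lemma \<rho>_irred_\<Omega>_pos:
  assumes "irred (Suc r) h" "\<rho> r h \<noteq> \<zero>\<^bsub>B r\<^esub>"
  shows "\<Omega> r (\<rho> r h) \<ge> 1"
  using assms \<rho>_local[where u=h and r=r] by (intro \<Omega>_pos) (auto elim: irreducibleE)

text \<open>
  Since \<open>\<rho> r\<close> maps nonunits to nonunits, it cannot decrease the number of irreducible factors of an element
  outside its kernel.
\<close>

lemma \<Omega>_le_\<Omega>_\<rho>:
  assumes "x \<in> carrier (B (Suc r))" "\<rho> r x \<noteq> \<zero>\<^bsub>B r\<^esub>"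
  shows "\<Omega> (Suc r) x \<le> \<Omega> r (\<rho> r x)"
  using assms
proof (induction "\<Omega> (Suc r) x" arbitrary: x rule: less_induct)
  case less
  have x: "x \<in> carrier (B (Suc r)) - {\<zero>\<^bsub>B (Suc r)\<^esub>}" using less by auto
  show ?case
  proof (cases "x \<in> Units (B (Suc r))")
    case True
    then show ?thesis using BM.factorcount_eq_0_iff[where a=x and r="Suc r"] x by simp
  next
    case False
    then obtain h y where hy: "irred (Suc r) h" "y \<in> carrier (B (Suc r)) - {\<zero>\<^bsub>B (Suc r)\<^esub>}"
        "x = h \<otimes>\<^bsub>B (Suc r)\<^esub> y"
      using irred_divisor_ex x by metis
    then have \<rho>x: "\<rho> r x = \<rho> r h \<otimes>\<^bsub>B r\<^esub> \<rho> r y" by simp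
    then have nz: "\<rho> r h \<noteq> \<zero>\<^bsub>B r\<^esub>" "\<rho> r y \<noteq> \<zero>\<^bsub>B r\<^esub>" using less.prems hy by auto
    have "\<Omega> (Suc r) x = 1 + \<Omega> (Suc r) y" using hy \<Omega>_mult \<Omega>_irred by simp
    moreover have "\<Omega> r (\<rho> r x) = \<Omega> r (\<rho> r h) + \<Omega> r (\<rho> r y)"
      unfolding \<rho>x using hy nz by (intro \<Omega>_mult) auto
    moreover have "\<Omega> (Suc r) y \<le> \<Omega> r (\<rho> r y)"
      using less.hyps[of y] hy nz calculation by simp
    ultimately show ?thesis using \<rho>_irred_\<Omega>_pos[where r=r and h=h] hy nz by simp
  qed
qed

text \<open>
  If \<open>\<rho> r\<close> preserves the number of irreducible factors of \<open>x\<close>, then it maps the irreducible factors of \<open>x\<close>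
  to irreducible elements. By unique factorization \<open>q\<close> is associated to one of these images, and it lifts
  because units lift.
\<close>

lemma irred_divisor_lift:
  assumes "x \<in> carrier (B (Suc r))" "\<rho> r x \<noteq> \<zero>\<^bsub>B r\<^esub>" "\<Omega> (Suc r) x = \<Omega> r (\<rho> r x)"
    and q: "irred r q" and "q divides\<^bsub>B r\<^esub> \<rho> r x"
  shows "\<exists>h. irred (Suc r) h \<and> h divides\<^bsub>B (Suc r)\<^esub> x \<and> \<rho> r h = q"
  using assms(1-3,5)
proof (induction "\<Omega> (Suc r) x" arbitrary: x rule: less_induct)
  case less
  have q_nonunit: "q \<notin> Units (B r)" using q by (auto elim: irreducibleE)
  have x: "x \<in> carrier (B (Suc r)) - {\<zero>\<^bsub>B (Suc r)\<^esub>}" using less by auto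
  have "x \<notin> Units (B (Suc r))"
  proof
    assume "x \<in> Units (B (Suc r))"
    then have "\<Omega> r (\<rho> r x) = 0"
      using BM.factorcount_eq_0_iff[where a=x and r="Suc r"] x less.prems by simp
    then have "\<rho> r x \<in> Units (B r)"
      using BM.factorcount_eq_0_iff[where a="\<rho> r x" and r=r] x less.prems by simp
    then have "q \<in> Units (B r)"
      using less.prems q B.divides_unit[where r=r and a=q and u="\<rho> r x"] by blast
    then show False using q_nonunit by simp
  qed
  then obtain h y where hy: "irred (Suc r) h" "y \<in> carrier (B (Suc r)) - {\<zero>\<^bsub>B (Suc r)\<^esub>}"
      "x = h \<otimes>\<^bsub>B (Suc r)\<^esub> y"
    using irred_divisor_ex x by metis
  then have \<rho>x: "\<rho> r x = \<rho> r h \<otimes>\<^bsub>B r\<^esub> \<rho> r y" by simp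
  then have nz: "\<rho> r h \<noteq> \<zero>\<^bsub>B r\<^esub>" "\<rho> r y \<noteq> \<zero>\<^bsub>B r\<^esub>" using less.prems hy by auto
  have "\<Omega> (Suc r) x = 1 + \<Omega> (Suc r) y" using hy \<Omega>_mult \<Omega>_irred by simp
  moreover have "\<Omega> r (\<rho> r x) = \<Omega> r (\<rho> r h) + \<Omega> r (\<rho> r y)"
    unfolding \<rho>x using hy nz by (intro \<Omega>_mult) auto
  moreover have "\<Omega> (Suc r) y \<le> \<Omega> r (\<rho> r y)" using \<Omega>_le_\<Omega>_\<rho> hy nz by simp
  moreover have "1 \<le> \<Omega> r (\<rho> r h)" using \<rho>_irred_\<Omega>_pos hy nz by simp
  ultimately have \<Omega>h: "\<Omega> r (\<rho> r h) = 1" and \<Omega>y: "\<Omega> (Suc r) y = \<Omega> r (\<rho> r y)" "\<Omega> (Suc r) y < \<Omega> (Suc r) x"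
    using less.prems by linarith+
  have \<rho>h: "irred r (\<rho> r h)"
    using \<Omega>h hy nz BM.irreducible_if_factorcount_1[where a="\<rho> r h" and r=r] by simp
  have "prime (B r) q"
    using q BM.irreducible_prime[where p=q and r=r] B.prime_eq_prime_mult[where p=q and r=r] by simp
  then have "q divides\<^bsub>B r\<^esub> \<rho> r h \<or> q divides\<^bsub>B r\<^esub> \<rho> r y"
    using less.prems hy by (simp add: prime_def \<rho>x)
  then show ?case
  proof
    assume "q divides\<^bsub>B r\<^esub> \<rho> r y"
    then obtain k where "irred (Suc r) k" "k divides\<^bsub>B (Suc r)\<^esub> y" "\<rho> r k = q"
      using less.hyps[of y] \<Omega>y hy nz by auto
    then show ?thesis
      using hy B.divides_prod_l[where r="Suc r" and a=k and b=y and c=h] by auto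
  next
    assume "q divides\<^bsub>B r\<^esub> \<rho> r h"
    then obtain v where v: "v \<in> carrier (B r)" "\<rho> r h = q \<otimes>\<^bsub>B r\<^esub> v" by (auto simp: factor_def)
    have "v \<in> Units (B r)"
      using B.ring_irreducibleE(5)[where r="\<rho> r h" and ra=r and a=q and b=v] B.ring_irreducibleI'[where r="\<rho> r h"] \<rho>h q v q_nonunit by auto
    then have w: "inv\<^bsub>B r\<^esub> v \<in> Units (B r)" "q = inv\<^bsub>B r\<^esub> v \<otimes>\<^bsub>B r\<^esub> \<rho> r h"
      using v q by (auto simp: B.m_ac B.Units_closed)
    then obtain u where u: "u \<in> carrier (B (Suc r))" "\<rho> r u = inv\<^bsub>B r\<^esub> v"
      using \<rho>_surj B.Units_closed by meson
    then have u': "u \<in> Units (B (Suc r))" using \<rho>_local w by simp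
    have uz: "u \<noteq> \<zero>\<^bsub>B (Suc r)\<^esub>"
      using u' B.Units_r_inv_ex[where x=u and r="Suc r"] by auto
    have "irred (Suc r) (u \<otimes>\<^bsub>B (Suc r)\<^esub> h)"
      using B.mult_of.irreducible_prod_lI[where r="Suc r" and b=h and a=u] hy u u' uz B.integral[where r="Suc r" and a=u and b=h] by auto
    moreover have "u \<otimes>\<^bsub>B (Suc r)\<^esub> h divides\<^bsub>B (Suc r)\<^esub> x"
    proof (rule dividesI)
      show "inv\<^bsub>B (Suc r)\<^esub> u \<otimes>\<^bsub>B (Suc r)\<^esub> y \<in> carrier (B (Suc r))" using u' hy by simp
      have "u \<otimes>\<^bsub>B (Suc r)\<^esub> h \<otimes>\<^bsub>B (Suc r)\<^esub> (inv\<^bsub>B (Suc r)\<^esub> u \<otimes>\<^bsub>B (Suc r)\<^esub> y)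
        = (u \<otimes>\<^bsub>B (Suc r)\<^esub> inv\<^bsub>B (Suc r)\<^esub> u) \<otimes>\<^bsub>B (Suc r)\<^esub> (h \<otimes>\<^bsub>B (Suc r)\<^esub> y)"
        using u u' hy by (simp add: B.m_ac del: B.Units_r_inv)
      then show "x = u \<otimes>\<^bsub>B (Suc r)\<^esub> h \<otimes>\<^bsub>B (Suc r)\<^esub> (inv\<^bsub>B (Suc r)\<^esub> u \<otimes>\<^bsub>B (Suc r)\<^esub> y)"
        using u' hy by simp
    qed
    moreover have "\<rho> r (u \<otimes>\<^bsub>B (Suc r)\<^esub> h) = q" using u w hy by simp
    ultimately show ?thesis by blast
  qed
qed

text \<open>
  The number of irreducible factors of \<open>\<pi> r f\<close> is eventually nonincreasing in \<open>r\<close>, so it is constant from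
  some level \<open>M\<close> on. An irreducible divisor of \<open>\<pi> M f\<close> then lifts step by step to a compatible sequence
  of irreducible divisors, whose limit is a prime divisor of \<open>f\<close>.
\<close>

lemma prime_divisor_ex:
  assumes f: "f \<in> carrier A" "f \<noteq> \<zero>" "f \<notin> Units A"
  shows "\<exists>p\<in>carrier A. prime A p \<and> p divides f"
proof -
  obtain N where N: "\<pi> N f \<noteq> \<zero>\<^bsub>B N\<^esub>" using \<pi>_nonzero_ex f by metis
  obtain M where M: "N \<le> M" "\<And>r. N \<le> r \<Longrightarrow> \<Omega> M (\<pi> M f) \<le> \<Omega> r (\<pi> r f)"
    using ex_has_least_nat[of "\<lambda>r. N \<le> r" N "\<lambda>r. \<Omega> r (\<pi> r f)"] by auto
  have nz: "\<pi> r f \<noteq> \<zero>\<^bsub>B r\<^esub>" if "M \<le> r" for r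
    using \<pi>_nonzero_upward N M(1) f that by simp
  have \<Omega>_const: "\<Omega> r (\<pi> r f) = \<Omega> M (\<pi> M f)" if "M \<le> r" for r
    using that
  proof (induction rule: dec_induct)
    case (step r)
    then have "\<Omega> (Suc r) (\<pi> (Suc r) f) \<le> \<Omega> M (\<pi> M f)"
      using \<Omega>_le_\<Omega>_\<rho>[of "\<pi> (Suc r) f" r] nz[of r] f \<rho>_\<pi> by simp
    moreover have "\<Omega> M (\<pi> M f) \<le> \<Omega> (Suc r) (\<pi> (Suc r) f)" using M step by simp
    ultimately show ?case by simp
  qed simp
  have "\<exists>c. \<forall>n. (irred (M + n) (c n) \<and> c n divides\<^bsub>B (M + n)\<^esub> \<pi> (M + n) f) \<and> \<rho> (M + n) (c (Suc n)) = c n"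
  proof (rule dependent_nat_choice)
    have "\<pi> M f \<notin> Units (B M)" using f Units_if_\<pi>_Units by blast
    then obtain q y where "irred M q" "y \<in> carrier (B M) - {\<zero>\<^bsub>B M\<^esub>}" "\<pi> M f = q \<otimes>\<^bsub>B M\<^esub> y"
      using irred_divisor_ex[of "\<pi> M f" M] nz f by auto
    then show "\<exists>q. irred (M + 0) q \<and> q divides\<^bsub>B (M + 0)\<^esub> \<pi> (M + 0) f"
      by (auto intro: dividesI)
  next
    fix q n assume "irred (M + n) q \<and> q divides\<^bsub>B (M + n)\<^esub> \<pi> (M + n) f"
    then show "\<exists>h. (irred (M + Suc n) h \<and> h divides\<^bsub>B (M + Suc n)\<^esub> \<pi> (M + Suc n) f) \<and> \<rho> (M + n) h = q"
      using irred_divisor_lift[of "\<pi> (Suc (M + n)) f" "M + n" q] nz[of "M + n"] f \<rho>_\<pi>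
        \<Omega>_const[of "M + n"] \<Omega>_const[of "Suc (M + n)"] by auto
  qed
  then obtain c where c: "\<And>n. irred (M + n) (c n)" "\<And>n. c n divides\<^bsub>B (M + n)\<^esub> \<pi> (M + n) f"
      "\<And>n. \<rho> (M + n) (c (Suc n)) = c n"
    by blast
  have "\<exists>p\<in>carrier A. \<forall>r\<ge>M. \<pi> r p = c (r - M)"
  proof (rule limit)
    fix r assume "M \<le> r"
    then show "c (r - M) \<in> carrier (B r)" "\<rho> r (c (Suc r - M)) = c (r - M)"
      using c(1,3)[of "r - M"] by (simp_all add: Suc_diff_le)
  qed
  then obtain p where p: "p \<in> carrier A" "\<And>r. M \<le> r \<Longrightarrow> \<pi> r p = c (r - M)" by blast
  have irr: "irred r (\<pi> r p)" "\<pi> r p divides\<^bsub>B r\<^esub> \<pi> r f" if "M \<le> r" for r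
    using c(1,2)[of "r - M"] p(2) that by simp_all
  have "prime A p" using p irr by (intro prime_if_\<pi>_irreducible[of _ M]) auto
  moreover have "p divides f"
    using p(1) irr f by (intro divides_if_\<pi>_divides[of _ M]) blast+
  ultimately show ?thesis using p by blast
qed

text \<open>
  Splitting off prime divisors terminates: each of them uses up at least one irreducible factor of the
  image of \<open>f\<close> at a fixed level \<open>N\<close> where this image is nonzero.
\<close>

theorem factorial_domain_limit: "factorial_domain A"
proof -
  have "f \<in> prime_products (mult_of A)" if "f \<in> carrier A" "\<pi> N f \<noteq> \<zero>\<^bsub>B N\<^esub>" for f N
    using that
  proof (induction "\<Omega> N (\<pi> N f)" arbitrary: f rule: less_induct)
    case less
    then have fz: "f \<noteq> \<zero>" by auto
    show ?case
    proof (cases "f \<in> Units A")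
      case True
      then show ?thesis by (simp add: prime_products.unit)
    next
      case False
      then obtain p g where p: "p \<in> carrier A" "prime A p" and g: "g \<in> carrier A" "f = p \<otimes> g"
        using prime_divisor_ex fz less.prems unfolding factor_def by blast
      have \<pi>f: "\<pi> N f = \<pi> N p \<otimes>\<^bsub>B N\<^esub> \<pi> N g" using p g by simp
      then have nz: "\<pi> N p \<noteq> \<zero>\<^bsub>B N\<^esub>" "\<pi> N g \<noteq> \<zero>\<^bsub>B N\<^esub>" using less.prems p g by auto
      have "p \<notin> Units A" using p by (auto elim: primeE)
      then have "1 \<le> \<Omega> N (\<pi> N p)"
        using Units_if_\<pi>_Units p nz by (intro \<Omega>_pos) auto
      moreover have "\<Omega> N (\<pi> N f) = \<Omega> N (\<pi> N p) + \<Omega> N (\<pi> N g)"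
        unfolding \<pi>f using p g nz by (intro \<Omega>_mult) auto
      ultimately have "g \<in> prime_products (mult_of A)"
        using less.hyps[of g] g nz by simp
      moreover have "p \<in> carrier A - {\<zero>}" using p nz by auto
      moreover have "prime (mult_of A) p" using A.prime_eq_prime_mult p by simp
      ultimately show ?thesis
        using prime_products.prime_mult[of p "mult_of A" g] g by simp
    qed
  qed
  then have "carrier A - {\<zero>} \<subseteq> prime_products (mult_of A)"
    using \<pi>_nonzero_ex by (metis DiffD1 DiffD2 insertI1 subsetI)
  then show ?thesis using A.factorial_domain_iff_prime_products by simp
qed

end

section \<open>Units and truncation of power series\<close>

lemma empty_in_monomials [simp]: "{#} \<in> monomials r"
  by (simp add: monomials_def)

lemma add_in_monomials_iff [simp]: "a + b \<in> monomials r \<longleftrightarrow> a \<in> monomials r \<and> b \<in> monomials r"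
  by (auto simp: monomials_def)

lemma monomials_mono: "r \<le> s \<Longrightarrow> m \<in> monomials r \<Longrightarrow> m \<in> monomials s"
  by (auto simp: monomials_def)

lemma ex_in_monomials: "\<exists>r\<ge>N. m \<in> monomials (Suc r)"
proof -
  obtain k where "\<forall>i\<in>set_mset m. i \<le> k"
    using finite_nat_set_iff_bounded_le[of "set_mset m"] by auto
  then show ?thesis
    by (intro exI[of _ "max N k"]) (auto simp: monomials_def)
qed

context cring
begin

lemma power_series_mult:
  "m \<in> monomials r \<Longrightarrow> (f \<otimes>\<^bsub>power_series_ring R r\<^esub> g) m
    = (\<Oplus>p\<in>{p. fst p + snd p = m}. f (fst p) \<otimes> g (snd p))"
  by (simp add: power_series_ring_def)

lemma power_series_closed:
  "f \<in> carrier (power_series_ring R r) \<Longrightarrow> m \<in> monomials r \<Longrightarrow> f m \<in> carrier R"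
  by (auto simp: power_series_ring_def)

lemma power_series_eqI:
  assumes "f \<in> carrier (power_series_ring R r)" "g \<in> carrier (power_series_ring R r)"
    and "\<And>m. m \<in> monomials r \<Longrightarrow> f m = g m"
  shows "f = g"
  using assms by (intro PiE_ext[of f "monomials r" "\<lambda>_. carrier R"]) (auto simp: power_series_ring_def)

lemma constant_coefficient_mult:
  assumes "f \<in> carrier (power_series_ring R r)" "g \<in> carrier (power_series_ring R r)"
  shows "(f \<otimes>\<^bsub>power_series_ring R r\<^esub> g) {#} = f {#} \<otimes> g {#}"
proof -
  have "{p :: nat multiset \<times> nat multiset. fst p + snd p = {#}} = {({#}, {#})}"
    by auto
  then show ?thesis
    using assms by (simp add: power_series_mult power_series_closed)
qed

lemma power_series_Units_iff:
  assumes PS: "cring (power_series_ring R r)" and f: "f \<in> carrier (power_series_ring R r)"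
  shows "f \<in> Units (power_series_ring R r) \<longleftrightarrow> f {#} \<in> Units R"
proof
  interpret PS: cring "power_series_ring R r" by (rule PS)
  assume "f \<in> Units (power_series_ring R r)"
  then obtain g where g: "g \<in> carrier (power_series_ring R r)"
      "f \<otimes>\<^bsub>power_series_ring R r\<^esub> g = \<one>\<^bsub>power_series_ring R r\<^esub>"
    using PS.Units_r_inv_ex by blast
  then have "f {#} \<otimes> g {#} = \<one>"
    using constant_coefficient_mult[OF f g(1)] by (simp add: power_series_ring_def)
  then show "f {#} \<in> Units R"
    using divides_one[of "f {#}"] power_series_closed f g
    by (metis dividesI empty_in_monomials)
next
  interpret PS: cring "power_series_ring R r" by (rule PS)
  assume unit: "f {#} \<in> Units R"
  let ?D = "\<lambda>m. {p :: nat multiset \<times> nat multiset. fst p + snd p = m} - {({#}, m)}"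
  \<comment> \<open>The coefficients of the inverse \<open>h\<close> are defined by recursion on the degree of the monomial: the
    equation for the coefficient of \<open>f h\<close> at \<open>m\<close> is solved for \<open>h m\<close>, which occurs in it with the
    invertible factor \<open>f {#}\<close>.\<close>
  define F where "F h m = inv (f {#}) \<otimes> ((if m = {#} then \<one> else \<zero>) \<ominus>
      (\<Oplus>p\<in>?D m. f (fst p) \<otimes> h (snd p)))" for h m
  define h where "h = wfrec (measure size) F"
  have smaller: "size (snd p) < size m" if "p \<in> ?D m" for p m
  proof -
    have "fst p \<noteq> {#}" using that by (cases p) auto
    moreover have "size m = size (fst p) + size (snd p)" using that by auto
    ultimately show ?thesis by (simp add: nonempty_has_size)
  qed
  have in_mon: "fst p \<in> monomials r" "snd p \<in> monomials r" if "m \<in> monomials r" "p \<in> ?D m" for p m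
    using that by auto
  have h_rec: "h m = F h m" if "\<And>b. size b < size m \<Longrightarrow> b \<in> monomials r \<Longrightarrow> h b \<in> carrier R"
    "m \<in> monomials r" for m
  proof -
    have "h m = F (cut h (measure size) m) m"
      unfolding h_def by (rule wfrec) simp
    also have "\<dots> = F h m"
    proof -
      have "(\<Oplus>p\<in>?D m. f (fst p) \<otimes> cut h (measure size) m (snd p)) = (\<Oplus>p\<in>?D m. f (fst p) \<otimes> h (snd p))"
      proof (rule add.finprod_cong')
        show "(\<lambda>p. f (fst p) \<otimes> h (snd p)) \<in> ?D m \<rightarrow> carrier R"
          using that smaller in_mon[OF that(2)] power_series_closed[OF f]
          by (intro Pi_I m_closed) blast+
        show "f (fst p) \<otimes> cut h (measure size) m (snd p) = f (fst p) \<otimes> h (snd p)" if "p \<in> ?D m" for p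
          using smaller[OF that] by (simp add: cut_apply)
      qed simp
      then show ?thesis unfolding F_def by simp
    qed
    finally show ?thesis .
  qed
  have h_closed: "m \<in> monomials r \<Longrightarrow> h m \<in> carrier R" for m
  proof (induction "size m" arbitrary: m rule: less_induct)
    case less
    have "(\<Oplus>p\<in>?D m. f (fst p) \<otimes> h (snd p)) \<in> carrier R"
      using less smaller in_mon[OF less.prems] power_series_closed[OF f]
      by (intro finsum_closed Pi_I m_closed) blast+
    then have "F h m \<in> carrier R"
      unfolding F_def using unit by auto
    moreover have "h m = F h m"
      using less by (intro h_rec) auto
    ultimately show ?case by simp
  qed
  define g where "g = restrict h (monomials r)"
  have g: "g \<in> carrier (power_series_ring R r)"
    using h_closed by (auto simp: g_def power_series_ring_def)
  have "f \<otimes>\<^bsub>power_series_ring R r\<^esub> g = \<one>\<^bsub>power_series_ring R r\<^esub>"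
  proof (rule power_series_eqI)
    fix m assume m: "m \<in> monomials r"
    define S where "S = (\<Oplus>p\<in>?D m. f (fst p) \<otimes> h (snd p))"
    have S: "S \<in> carrier R"
      unfolding S_def using in_mon[OF m] power_series_closed[OF f] h_closed
      by (intro finsum_closed Pi_I m_closed) blast+
    have D: "{p :: nat multiset \<times> nat multiset. fst p + snd p = m} = insert ({#}, m) (?D m)"
      by auto
    have "(f \<otimes>\<^bsub>power_series_ring R r\<^esub> g) m = (\<Oplus>p\<in>{p. fst p + snd p = m}. f (fst p) \<otimes> h (snd p))"
      unfolding power_series_mult[OF m] using m power_series_closed[OF f] h_closed
      by (intro add.finprod_cong') (auto simp: g_def)
    also have "\<dots> = f {#} \<otimes> h m \<oplus> S"
      unfolding S_def by (subst D, subst finsum_insert)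
        (use finite_monomial_decompositions[of m] in_mon[OF m] power_series_closed[OF f] h_closed m in auto)
    also have "h m = inv (f {#}) \<otimes> ((if m = {#} then \<one> else \<zero>) \<ominus> S)"
      using h_rec[OF h_closed m] by (simp add: F_def S_def)
    also have "f {#} \<otimes> \<dots> = (if m = {#} then \<one> else \<zero>) \<ominus> S"
      using unit S by (simp add: m_assoc[symmetric] Units_closed)
    also have "\<dots> \<oplus> S = (if m = {#} then \<one> else \<zero>)"
      using S by (auto simp: minus_eq a_assoc l_neg)
    also have "\<dots> = \<one>\<^bsub>power_series_ring R r\<^esub> m"
      using m by (simp add: power_series_ring_def)
    finally show "(f \<otimes>\<^bsub>power_series_ring R r\<^esub> g) m = \<one>\<^bsub>power_series_ring R r\<^esub> m" .
  qed (use f g in auto)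
  then show "f \<in> Units (power_series_ring R r)"
    using f g PS.divides_one by (metis dividesI)
qed

text \<open>Discarding the monomials that involve the last variable amounts to setting this variable to zero.\<close>

lemma truncation_ring_hom:
  "(\<lambda>f. restrict f (monomials r)) \<in> ring_hom (power_series_ring R (Suc r)) (power_series_ring R r)"
proof -
  have sub: "m \<in> monomials (Suc r)" if "m \<in> monomials r" for m
    using monomials_mono[of r "Suc r"] that by simp
  show ?thesis
  proof (rule ring_hom_memI)
    fix f g
    assume f: "f \<in> carrier (power_series_ring R (Suc r))" and g: "g \<in> carrier (power_series_ring R (Suc r))"
    show "restrict f (monomials r) \<in> carrier (power_series_ring R r)"
      using f sub by (auto simp: power_series_ring_def)
    show "restrict (f \<oplus>\<^bsub>power_series_ring R (Suc r)\<^esub> g) (monomials r)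
        = restrict f (monomials r) \<oplus>\<^bsub>power_series_ring R r\<^esub> restrict g (monomials r)"
      using sub by (auto simp: power_series_ring_def restrict_def)
    have "(f \<otimes>\<^bsub>power_series_ring R (Suc r)\<^esub> g) m
        = (restrict f (monomials r) \<otimes>\<^bsub>power_series_ring R r\<^esub> restrict g (monomials r)) m"
      if m: "m \<in> monomials r" for m
      unfolding power_series_mult[OF m] power_series_mult[OF sub[OF m]]
      using m sub power_series_closed[OF f] power_series_closed[OF g]
      by (intro add.finprod_cong') auto
    then show "restrict (f \<otimes>\<^bsub>power_series_ring R (Suc r)\<^esub> g) (monomials r)
        = restrict f (monomials r) \<otimes>\<^bsub>power_series_ring R r\<^esub> restrict g (monomials r)"
      by (auto simp: power_series_ring_def restrict_def)
  next
    show "restrict \<one>\<^bsub>power_series_ring R (Suc r)\<^esub> (monomials r) = \<one>\<^bsub>power_series_ring R r\<^esub>"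
      using sub by (auto simp: power_series_ring_def restrict_def)
  qed
qed

end

section \<open>Monomials and positive integers\<close>

text \<open>
  The positive integer of a monomial, in which the \<open>i\<close>-th variable becomes the \<open>i\<close>-th prime number. By
  unique factorization of integers this is a bijection from the monomials to the positive integers.
\<close>

definition monomial_value :: "nat multiset \<Rightarrow> nat"
  where "monomial_value m = (\<Prod>i\<in>#m. enumerate {p. Factorial_Ring.prime p} i)"

lemma enumerate_prime: "Factorial_Ring.prime (enumerate {p :: nat. Factorial_Ring.prime p} i)"
  using enumerate_in_set[OF primes_infinite] by simp

lemma monomial_value_empty [simp]: "monomial_value {#} = 1"
  by (simp add: monomial_value_def)

lemma monomial_value_add [simp]: "monomial_value (a + b) = monomial_value a * monomial_value b"
  by (simp add: monomial_value_def)

lemma prime_factorization_monomial_value: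
  "prime_factorization (monomial_value m) = image_mset (enumerate {p. Factorial_Ring.prime p}) m"
  unfolding monomial_value_def
  by (rule prime_factorization_prod_mset_primes) (auto simp: enumerate_prime)

lemma monomial_value_pos [simp]: "0 < monomial_value m"
proof -
  have "0 < enumerate {p :: nat. Factorial_Ring.prime p} i" for i
    by (rule prime_gt_0_nat[OF enumerate_prime])
  then show ?thesis
    unfolding monomial_value_def by (induction m) simp_all
qed

lemma monomial_value_eq_iff [simp]: "monomial_value a = monomial_value b \<longleftrightarrow> a = b"
proof
  assume "monomial_value a = monomial_value b"
  then have "prime_factorization (monomial_value a) = prime_factorization (monomial_value b)"
    by simp
  then have "image_mset (enumerate {p :: nat. Factorial_Ring.prime p}) a
      = image_mset (enumerate {p. Factorial_Ring.prime p}) b"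
    by (simp only: prime_factorization_monomial_value)
  moreover have "inj (enumerate {p :: nat. Factorial_Ring.prime p})"
    using strict_mono_enumerate[OF primes_infinite] by (rule strict_mono_imp_inj_on)
  ultimately show "a = b"
    using injD[OF multiset.inj_map] by blast
qed simp

lemma monomial_value_surj:
  assumes "0 < n"
  obtains m where "n = monomial_value m"
proof -
  let ?e = "enumerate {p :: nat. Factorial_Ring.prime p}"
  have "\<exists>m. image_mset ?e m = prime_factorization n"
  proof -
    have "\<forall>p\<in>#prime_factorization n. p \<in> range ?e"
      using range_enumerate[OF primes_infinite] by (auto simp: in_prime_factors_iff)
    then have "image_mset ?e (image_mset (inv_into UNIV ?e) (prime_factorization n)) = prime_factorization n"
      by (auto simp: multiset.map_comp o_def f_inv_into_f intro: multiset.map_ident_strong)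
    then show ?thesis by blast
  qed
  then obtain m where "image_mset ?e m = prime_factorization n" by blast
  then have "monomial_value m = n"
    using assms unfolding monomial_value_def by (simp add: prod_mset_prime_factorization_nat)
  then show thesis using that by blast
qed

section \<open>Functions with bounded denominators\<close>

text \<open>
  The functions \<open>\<alpha>\<close> for which \<open>d\<close> is a common denominator of all the points of the support. For \<open>d = 1\<close> these
  are the arithmetic functions, supported on the positive integers, with Dirichlet convolution as product.
\<close>

definition functions_with_denom :: "('a, 'm) ring_scheme \<Rightarrow> nat \<Rightarrow> (rat \<Rightarrow> 'a) set"
  where "functions_with_denom R d =
    {\<alpha> \<in> pos_rats \<rightarrow>\<^sub>E carrier R. \<forall>q\<in>pos_rats. \<alpha> q \<noteq> \<zero>\<^bsub>R\<^esub> \<longrightarrow> of_nat d * q \<in> pos_nats}"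

text \<open>
  The value of \<open>\<alpha>\<close> at \<open>n / d\<close>, where \<open>n\<close> is the positive integer of the monomial \<open>m\<close>, is read as the
  coefficient of \<open>m\<close>. Only the monomials in the first \<open>r\<close> variables are kept.
\<close>

definition coefficient_series :: "nat \<Rightarrow> nat \<Rightarrow> (rat \<Rightarrow> 'a) \<Rightarrow> nat multiset \<Rightarrow> 'a"
  where "coefficient_series d r \<alpha> =
    (\<lambda>m\<in>monomials r. \<alpha> (of_nat (monomial_value m) / of_nat d))"

text \<open>The indicator function of the point \<open>x\<close>.\<close>

definition delta_function :: "('a, 'm) ring_scheme \<Rightarrow> rat \<Rightarrow> rat \<Rightarrow> 'a"
  where "delta_function R x = (\<lambda>q\<in>pos_rats. if q = x then \<one>\<^bsub>R\<^esub> else \<zero>\<^bsub>R\<^esub>)"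

lemma pos_nats_iff: "q \<in> pos_nats \<longleftrightarrow> (\<exists>m. q = of_nat (monomial_value m))"
  unfolding pos_nats_def using monomial_value_pos monomial_value_surj
  by (smt (verit, best) mem_Collect_eq)

lemma pos_nats_mult: "x \<in> pos_nats \<Longrightarrow> y \<in> pos_nats \<Longrightarrow> x * y \<in> pos_nats"
  by (force simp: pos_nats_def simp flip: of_nat_mult)

lemma of_nat_in_pos_nats: "0 < n \<Longrightarrow> of_nat n \<in> pos_nats"
  by (auto simp: pos_nats_def)

lemma value_div_in_pos_rats: "0 < d \<Longrightarrow> of_nat (monomial_value m) / of_nat d \<in> pos_rats"
  by (simp add: pos_rats_def)

lemma bounded_denom_functions_eq:
  "bounded_denom_functions R = (\<Union>d\<in>{0<..}. functions_with_denom R d)"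
  by (auto simp: bounded_denom_functions_def functions_with_denom_def pos_nats_def)

lemma functions_with_denom_mono:
  assumes "0 < e"
  shows "functions_with_denom R d \<subseteq> functions_with_denom R (d * e)"
proof -
  have "of_nat (d * e) * q \<in> pos_nats" if "of_nat d * q \<in> pos_nats" for q :: rat
    using pos_nats_mult[OF of_nat_in_pos_nats[OF assms] that] by (simp add: mult_ac)
  then show ?thesis by (auto simp: functions_with_denom_def)
qed

lemma carrier_bounded_denom_ring: "carrier (bounded_denom_ring R) = bounded_denom_functions R"
  by (simp add: bounded_denom_ring_def)

lemma in_bounded_denom_ringI:
  "\<alpha> \<in> functions_with_denom R d \<Longrightarrow> 0 < d \<Longrightarrow> \<alpha> \<in> carrier (bounded_denom_ring R)"
  by (auto simp: carrier_bounded_denom_ring bounded_denom_functions_eq)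

lemma in_bounded_denom_ringE:
  assumes "\<alpha> \<in> carrier (bounded_denom_ring R)"
  obtains d where "0 < d" "\<alpha> \<in> functions_with_denom R d"
  using assms by (auto simp: carrier_bounded_denom_ring bounded_denom_functions_eq)

lemma common_denom:
  assumes "\<alpha> \<in> carrier (bounded_denom_ring R)" "\<beta> \<in> carrier (bounded_denom_ring R)"
  obtains d where "0 < d" "\<alpha> \<in> functions_with_denom R d" "\<beta> \<in> functions_with_denom R d"
proof -
  obtain d e where "0 < d" "\<alpha> \<in> functions_with_denom R d" "0 < e" "\<beta> \<in> functions_with_denom R e"
    using in_bounded_denom_ringE assms by metis
  then show thesis
    using functions_with_denom_mono[of e R d] functions_with_denom_mono[of d R e]
    by (intro that[of "d * e"]) (auto simp: mult.commute)
qed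

lemma functions_with_denom_closed:
  "\<alpha> \<in> functions_with_denom R d \<Longrightarrow> q \<in> pos_rats \<Longrightarrow> \<alpha> q \<in> carrier R"
  by (auto simp: functions_with_denom_def)

text \<open>Every monomial involves finitely many variables, so the truncated series together determine \<open>\<alpha>\<close>.\<close>

lemma functions_with_denom_eqI:
  assumes d: "0 < d" and \<alpha>: "\<alpha> \<in> functions_with_denom R d" and \<beta>: "\<beta> \<in> functions_with_denom R d"
    and eq: "\<And>r. coefficient_series d (Suc r) \<alpha> = coefficient_series d (Suc r) \<beta>"
  shows "\<alpha> = \<beta>"
proof (rule PiE_ext)
  show "\<alpha> \<in> pos_rats \<rightarrow>\<^sub>E carrier R" "\<beta> \<in> pos_rats \<rightarrow>\<^sub>E carrier R"
    using \<alpha> \<beta> by (auto simp: functions_with_denom_def)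
  fix q assume q: "q \<in> pos_rats"
  show "\<alpha> q = \<beta> q"
  proof (cases "of_nat d * q \<in> pos_nats")
    case True
    then obtain m where "of_nat d * q = of_nat (monomial_value m)" by (auto simp: pos_nats_iff)
    then have qm: "q = of_nat (monomial_value m) / of_nat d" using d by (simp add: field_simps)
    obtain r where "m \<in> monomials (Suc r)" using ex_in_monomials by blast
    then show ?thesis
      using fun_cong[OF eq[of r], of m] by (simp add: coefficient_series_def qm)
  next
    case False
    then show ?thesis using \<alpha> \<beta> q by (auto simp: functions_with_denom_def)
  qed
qed

context cring
begin

lemma coefficient_series_closed:
  assumes "0 < d" "\<alpha> \<in> functions_with_denom R d"
  shows "coefficient_series d r \<alpha> \<in> carrier (power_series_ring R r)"
  using functions_with_denom_closed[OF assms(2) value_div_in_pos_rats[OF assms(1)]]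
  by (auto simp: coefficient_series_def power_series_ring_def)

lemma mult_functions_with_denom:
  assumes d: "0 < d" "\<alpha> \<in> functions_with_denom R d" and e: "0 < e" "\<beta> \<in> functions_with_denom R e"
  shows "\<alpha> \<otimes>\<^bsub>bounded_denom_ring R\<^esub> \<beta> \<in> functions_with_denom R (d * e)"
proof -
  let ?c = "\<alpha> \<otimes>\<^bsub>bounded_denom_ring R\<^esub> \<beta>"
  have "?c \<in> pos_rats \<rightarrow>\<^sub>E carrier R"
    using functions_with_denom_closed[OF d(2)] functions_with_denom_closed[OF e(2)]
    by (auto simp: bounded_denom_ring_def conv_support_def intro!: finsum_closed)
  moreover have "of_nat (d * e) * q \<in> pos_nats" if q: "q \<in> pos_rats" "?c q \<noteq> \<zero>" for q
  proof -
    have "conv_support R \<alpha> \<beta> q \<noteq> {}"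
      using q by (auto simp: bounded_denom_ring_def)
    then obtain x y where xy: "x \<in> pos_rats" "y \<in> pos_rats" "x * y = q" "\<alpha> x \<noteq> \<zero>" "\<beta> y \<noteq> \<zero>"
      by (auto simp: conv_support_def)
    then have "(of_nat d * x) * (of_nat e * y) \<in> pos_nats"
      using d e by (intro pos_nats_mult[of "of_nat d * x"]) (auto simp: functions_with_denom_def)
    then show ?thesis using xy(3)[symmetric] by (simp add: mult_ac)
  qed
  ultimately show ?thesis by (simp add: functions_with_denom_def)
qed

text \<open>
  The product of the functions corresponds to the product of the series, and the common denominators
  multiply. The factorizations of \<open>q\<close> in the support of the convolution are among those that come from
  the decompositions of the monomial of \<open>q\<close>, and the remaining decompositions contribute zero.
\<close>

lemma coefficient_series_mult:
  assumes d: "0 < d" "\<alpha> \<in> functions_with_denom R d" and e: "0 < e" "\<beta> \<in> functions_with_denom R e"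
  shows "coefficient_series (d * e) r (\<alpha> \<otimes>\<^bsub>bounded_denom_ring R\<^esub> \<beta>)
    = coefficient_series d r \<alpha> \<otimes>\<^bsub>power_series_ring R r\<^esub> coefficient_series e r \<beta>"
proof -
  have "(\<alpha> \<otimes>\<^bsub>bounded_denom_ring R\<^esub> \<beta>) (of_nat (monomial_value m) / of_nat (d * e))
    = (coefficient_series d r \<alpha> \<otimes>\<^bsub>power_series_ring R r\<^esub> coefficient_series e r \<beta>) m"
    if m: "m \<in> monomials r" for m
  proof -
    define q :: rat where "q = of_nat (monomial_value m) / of_nat (d * e)"
    define h :: "nat multiset \<times> nat multiset \<Rightarrow> rat \<times> rat"
      where "h p = (of_nat (monomial_value (fst p)) / of_nat d, of_nat (monomial_value (snd p)) / of_nat e)" for p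
    let ?D = "{p :: nat multiset \<times> nat multiset. fst p + snd p = m}"
    let ?g = "\<lambda>p. \<alpha> (fst p) \<otimes> \<beta> (snd p)"
    have q: "q \<in> pos_rats" unfolding q_def using d e by (intro value_div_in_pos_rats) simp
    have hD: "fst x \<in> pos_rats" "snd x \<in> pos_rats" "fst x * snd x = q" if "x \<in> h ` ?D" for x
      using that d e by (auto simp: h_def q_def intro: value_div_in_pos_rats)
    have g: "?g \<in> h ` ?D \<rightarrow> carrier R"
      using hD functions_with_denom_closed[OF d(2)] functions_with_denom_closed[OF e(2)] by blast
    have "inj h"
      using d e by (auto simp: inj_def h_def)
    have sub: "conv_support R \<alpha> \<beta> q \<subseteq> h ` ?D"
    proof
      fix x assume x: "x \<in> conv_support R \<alpha> \<beta> q"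
      then have "of_nat d * fst x \<in> pos_nats" "of_nat e * snd x \<in> pos_nats" "fst x * snd x = q"
        using d e by (auto simp: conv_support_def functions_with_denom_def)
      then obtain a b where ab: "of_nat d * fst x = of_nat (monomial_value a)"
          "of_nat e * snd x = of_nat (monomial_value b)"
        by (auto simp: pos_nats_iff)
      then have hx: "x = h (a, b)"
        using d e by (auto simp: h_def prod_eq_iff field_simps)
      have "(of_nat (monomial_value m) :: rat) = (of_nat d * fst x) * (of_nat e * snd x)"
        using \<open>fst x * snd x = q\<close> d e by (simp add: q_def field_simps)
      also have "\<dots> = of_nat (monomial_value (a + b))"
        by (simp add: ab)
      finally have "m = a + b" by (simp only: of_nat_eq_iff monomial_value_eq_iff)
      then show "x \<in> h ` ?D" using hx by auto
    qed
    have "(\<alpha> \<otimes>\<^bsub>bounded_denom_ring R\<^esub> \<beta>) q = (\<Oplus>x\<in>conv_support R \<alpha> \<beta> q. ?g x)"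
      using q by (simp add: bounded_denom_ring_def)
    also have "\<dots> = (\<Oplus>x\<in>h ` ?D. ?g x)"
    proof (rule add.finprod_mono_neutral_cong_left)
      show "finite (h ` ?D)" by (intro finite_imageI finite_monomial_decompositions)
      fix x assume x: "x \<in> h ` ?D - conv_support R \<alpha> \<beta> q"
      then have "\<alpha> (fst x) = \<zero> \<or> \<beta> (snd x) = \<zero>"
        using hD[of x] by (auto simp: conv_support_def mem_Times_iff)
      then show "?g x = \<zero>"
        using x hD[of x] functions_with_denom_closed[OF d(2)] functions_with_denom_closed[OF e(2)] by auto
    qed (use sub g in auto)
    also have "\<dots> = (\<Oplus>p\<in>?D. ?g (h p))"
      using g \<open>inj h\<close> by (intro add.finprod_reindex) (auto intro: inj_on_subset)
    also have "\<dots> = (\<Oplus>p\<in>?D. coefficient_series d r \<alpha> (fst p) \<otimes> coefficient_series e r \<beta> (snd p))"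
      using m power_series_closed[OF coefficient_series_closed[OF d]]
        power_series_closed[OF coefficient_series_closed[OF e]]
      by (intro add.finprod_cong') (auto simp: coefficient_series_def h_def)
    finally show ?thesis
      by (simp only: power_series_mult[OF m] q_def)
  qed
  then show ?thesis
    by (auto simp: coefficient_series_def[of "d * e"] power_series_ring_def restrict_def)
qed

lemma coefficient_series_add:
  assumes "0 < d"
  shows "coefficient_series d r (\<alpha> \<oplus>\<^bsub>bounded_denom_ring R\<^esub> \<beta>)
    = coefficient_series d r \<alpha> \<oplus>\<^bsub>power_series_ring R r\<^esub> coefficient_series d r \<beta>"
  using value_div_in_pos_rats[OF assms]
  by (auto simp: coefficient_series_def power_series_ring_def bounded_denom_ring_def restrict_def)

lemma coefficient_series_one:
  "coefficient_series 1 r \<one>\<^bsub>bounded_denom_ring R\<^esub> = \<one>\<^bsub>power_series_ring R r\<^esub>"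
proof -
  have "of_nat (monomial_value m) = (1 :: rat) \<longleftrightarrow> m = {#}" for m
    using monomial_value_eq_iff[of m "{#}"] by (simp del: monomial_value_eq_iff)
  then show ?thesis
    using value_div_in_pos_rats[of 1]
    by (auto simp: coefficient_series_def power_series_ring_def bounded_denom_ring_def restrict_def)
qed

lemma delta_function_with_denom:
  assumes "of_nat d * x \<in> pos_nats"
  shows "delta_function R x \<in> functions_with_denom R d"
  using assms by (auto simp: delta_function_def functions_with_denom_def)

lemma one_bounded_denom_ring: "\<one>\<^bsub>bounded_denom_ring R\<^esub> = delta_function R 1"
  by (simp add: bounded_denom_ring_def delta_function_def)

lemma one_with_denom: "\<one>\<^bsub>bounded_denom_ring R\<^esub> \<in> functions_with_denom R 1"
  unfolding one_bounded_denom_ring by (rule delta_function_with_denom) (simp add: pos_nats_iff exI[of _ "{#}"])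

lemma add_with_denom:
  assumes "\<alpha> \<in> functions_with_denom R d" "\<beta> \<in> functions_with_denom R d"
  shows "\<alpha> \<oplus>\<^bsub>bounded_denom_ring R\<^esub> \<beta> \<in> functions_with_denom R d"
  using assms by (fastforce simp: functions_with_denom_def bounded_denom_ring_def)

lemma uminus_with_denom:
  assumes "\<alpha> \<in> functions_with_denom R d"
  shows "(\<lambda>q\<in>pos_rats. \<ominus> \<alpha> q) \<in> functions_with_denom R d"
  using assms by (fastforce simp: functions_with_denom_def)

lemma uminus_add_bounded_denom:
  assumes "\<alpha> \<in> functions_with_denom R d"
  shows "(\<lambda>q\<in>pos_rats. \<ominus> \<alpha> q) \<oplus>\<^bsub>bounded_denom_ring R\<^esub> \<alpha> = \<zero>\<^bsub>bounded_denom_ring R\<^esub>"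
  using functions_with_denom_closed[OF assms]
  by (auto simp: bounded_denom_ring_def l_neg restrict_def)

lemma bounded_denom_ring_abelian_group: "abelian_group (bounded_denom_ring R)"
proof (rule abelian_groupI)
  fix x y assume "x \<in> carrier (bounded_denom_ring R)" "y \<in> carrier (bounded_denom_ring R)"
  then obtain d where d: "0 < d" "x \<in> functions_with_denom R d" "y \<in> functions_with_denom R d"
    by (rule common_denom)
  then show "x \<oplus>\<^bsub>bounded_denom_ring R\<^esub> y \<in> carrier (bounded_denom_ring R)"
    using add_with_denom in_bounded_denom_ringI by blast
  show "x \<oplus>\<^bsub>bounded_denom_ring R\<^esub> y = y \<oplus>\<^bsub>bounded_denom_ring R\<^esub> x"
    using d by (auto simp: bounded_denom_ring_def restrict_def functions_with_denom_closed a_comm)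
next
  have "\<zero>\<^bsub>bounded_denom_ring R\<^esub> \<in> functions_with_denom R 1"
    by (auto simp: bounded_denom_ring_def functions_with_denom_def)
  then show "\<zero>\<^bsub>bounded_denom_ring R\<^esub> \<in> carrier (bounded_denom_ring R)"
    by (rule in_bounded_denom_ringI) simp
next
  fix x y z
  assume "x \<in> carrier (bounded_denom_ring R)" "y \<in> carrier (bounded_denom_ring R)"
    "z \<in> carrier (bounded_denom_ring R)"
  then have "x q \<in> carrier R" "y q \<in> carrier R" "z q \<in> carrier R" if "q \<in> pos_rats" for q
    using that by (auto simp: carrier_bounded_denom_ring bounded_denom_functions_def)
  then show "x \<oplus>\<^bsub>bounded_denom_ring R\<^esub> y \<oplus>\<^bsub>bounded_denom_ring R\<^esub> z
      = x \<oplus>\<^bsub>bounded_denom_ring R\<^esub> (y \<oplus>\<^bsub>bounded_denom_ring R\<^esub> z)"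
    by (auto simp: bounded_denom_ring_def restrict_def a_assoc)
next
  fix x assume "x \<in> carrier (bounded_denom_ring R)"
  then obtain d where d: "0 < d" "x \<in> functions_with_denom R d" by (rule in_bounded_denom_ringE)
  then have "x \<in> pos_rats \<rightarrow>\<^sub>E carrier R" by (auto simp: functions_with_denom_def)
  then show "\<zero>\<^bsub>bounded_denom_ring R\<^esub> \<oplus>\<^bsub>bounded_denom_ring R\<^esub> x = x"
    using functions_with_denom_closed[OF d(2)]
    by (intro PiE_ext[of _ pos_rats "\<lambda>_. carrier R"]) (auto simp: bounded_denom_ring_def)
  show "\<exists>y\<in>carrier (bounded_denom_ring R). y \<oplus>\<^bsub>bounded_denom_ring R\<^esub> x = \<zero>\<^bsub>bounded_denom_ring R\<^esub>"
    using uminus_add_bounded_denom uminus_with_denom d in_bounded_denom_ringI by blast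
qed

text \<open>
  The laws of multiplication are inherited from the power series rings, because the coefficient series
  determine a function and turn products into products.
\<close>

lemma bounded_denom_ring_cring:
  assumes PS: "\<And>r. cring (power_series_ring R (Suc r))"
  shows "cring (bounded_denom_ring R)"
proof (rule cringI)
  interpret PS: cring "power_series_ring R (Suc r)" for r by (rule PS)
  let ?T = "bounded_denom_ring R"
  show "abelian_group ?T" by (rule bounded_denom_ring_abelian_group)
  show "comm_monoid ?T"
  proof (rule comm_monoidI)
    fix x y assume "x \<in> carrier ?T" "y \<in> carrier ?T"
    then obtain d where d: "0 < d" and xy: "x \<in> functions_with_denom R d" "y \<in> functions_with_denom R d"
      by (rule common_denom)
    have dd: "0 < d * d" using d by simp
    note xy_mult = mult_functions_with_denom[OF d xy(1) d xy(2)]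
      and yx_mult = mult_functions_with_denom[OF d xy(2) d xy(1)]
    show "x \<otimes>\<^bsub>?T\<^esub> y \<in> carrier ?T" by (rule in_bounded_denom_ringI[OF xy_mult dd])
    show "x \<otimes>\<^bsub>?T\<^esub> y = y \<otimes>\<^bsub>?T\<^esub> x"
      by (rule functions_with_denom_eqI[OF dd xy_mult yx_mult])
        (simp add: coefficient_series_mult d xy coefficient_series_closed PS.m_comm)
  next
    show "\<one>\<^bsub>?T\<^esub> \<in> carrier ?T" by (rule in_bounded_denom_ringI[OF one_with_denom]) simp
  next
    fix x y z assume "x \<in> carrier ?T" "y \<in> carrier ?T" "z \<in> carrier ?T"
    then obtain a b c where abc: "0 < a" "0 < b" "0 < c"
      and x: "x \<in> functions_with_denom R a" and y: "y \<in> functions_with_denom R b"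
      and z: "z \<in> functions_with_denom R c"
      using in_bounded_denom_ringE by metis
    note xy = mult_functions_with_denom[OF abc(1) x abc(2) y]
      and yz = mult_functions_with_denom[OF abc(2) y abc(3) z]
    have ab: "0 < a * b" and bc: "0 < b * c" and abc': "0 < a * b * c" using abc by simp_all
    note xy_z = mult_functions_with_denom[OF ab xy abc(3) z]
      and x_yz = mult_functions_with_denom[OF abc(1) x bc yz, folded mult.assoc]
    show "x \<otimes>\<^bsub>?T\<^esub> y \<otimes>\<^bsub>?T\<^esub> z = x \<otimes>\<^bsub>?T\<^esub> (y \<otimes>\<^bsub>?T\<^esub> z)"
    proof (rule functions_with_denom_eqI[OF abc' xy_z x_yz])
      fix r
      have "coefficient_series (a * b * c) (Suc r) (x \<otimes>\<^bsub>?T\<^esub> y \<otimes>\<^bsub>?T\<^esub> z)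
        = coefficient_series a (Suc r) x \<otimes>\<^bsub>power_series_ring R (Suc r)\<^esub>
          (coefficient_series b (Suc r) y \<otimes>\<^bsub>power_series_ring R (Suc r)\<^esub> coefficient_series c (Suc r) z)"
        using abc x y z
        by (simp add: coefficient_series_mult[OF ab xy abc(3) z] coefficient_series_mult[OF abc(1) x abc(2) y]
            coefficient_series_closed PS.m_assoc)
      also have "\<dots> = coefficient_series (a * b * c) (Suc r) (x \<otimes>\<^bsub>?T\<^esub> (y \<otimes>\<^bsub>?T\<^esub> z))"
        by (simp add: coefficient_series_mult[OF abc(1) x bc yz] coefficient_series_mult[OF abc(2) y abc(3) z]
            mult.assoc)
      finally show "coefficient_series (a * b * c) (Suc r) (x \<otimes>\<^bsub>?T\<^esub> y \<otimes>\<^bsub>?T\<^esub> z)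
        = coefficient_series (a * b * c) (Suc r) (x \<otimes>\<^bsub>?T\<^esub> (y \<otimes>\<^bsub>?T\<^esub> z))" .
    qed
  next
    fix x assume "x \<in> carrier ?T"
    then obtain d where d: "0 < d" "x \<in> functions_with_denom R d" by (rule in_bounded_denom_ringE)
    note 1 = mult_functions_with_denom[OF zero_less_one one_with_denom d, simplified]
    show "\<one>\<^bsub>?T\<^esub> \<otimes>\<^bsub>?T\<^esub> x = x"
    proof (rule functions_with_denom_eqI[OF d(1) 1 d(2)])
      fix r
      show "coefficient_series d (Suc r) (\<one>\<^bsub>?T\<^esub> \<otimes>\<^bsub>?T\<^esub> x) = coefficient_series d (Suc r) x"
        using coefficient_series_mult[OF zero_less_one one_with_denom d, of "Suc r"]
          coefficient_series_closed[OF d] by (simp add: coefficient_series_one[unfolded One_nat_def])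
    qed
  qed
next
  interpret PS: cring "power_series_ring R (Suc r)" for r by (rule PS)
  let ?T = "bounded_denom_ring R"
  fix x y z assume "x \<in> carrier ?T" "y \<in> carrier ?T" and "z \<in> carrier ?T"
  then obtain d e where d: "0 < d" "x \<in> functions_with_denom R d" "y \<in> functions_with_denom R d"
    and e: "0 < e" "z \<in> functions_with_denom R e"
    using common_denom in_bounded_denom_ringE by metis
  have de: "0 < d * e" using d e by simp
  note xy = add_with_denom[OF d(2,3)]
  note xz = mult_functions_with_denom[OF d(1,2) e] and yz = mult_functions_with_denom[OF d(1,3) e]
  show "(x \<oplus>\<^bsub>?T\<^esub> y) \<otimes>\<^bsub>?T\<^esub> z = x \<otimes>\<^bsub>?T\<^esub> z \<oplus>\<^bsub>?T\<^esub> y \<otimes>\<^bsub>?T\<^esub> z"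
  proof (rule functions_with_denom_eqI[OF de mult_functions_with_denom[OF d(1) xy e] add_with_denom[OF xz yz]])
    fix r
    show "coefficient_series (d * e) (Suc r) ((x \<oplus>\<^bsub>?T\<^esub> y) \<otimes>\<^bsub>?T\<^esub> z)
      = coefficient_series (d * e) (Suc r) (x \<otimes>\<^bsub>?T\<^esub> z \<oplus>\<^bsub>?T\<^esub> y \<otimes>\<^bsub>?T\<^esub> z)"
      using d e by (simp add: coefficient_series_mult[OF d(1) xy e] coefficient_series_mult[OF d(1,2) e]
          coefficient_series_mult[OF d(1,3) e] coefficient_series_add[OF d(1)] coefficient_series_add[OF de]
          coefficient_series_closed PS.l_distr)
  qed
qed

lemma delta_function_mult:
  assumes one_not_zero: "\<one> \<noteq> \<zero>" and x: "x \<in> pos_rats"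
    and \<alpha>: "\<alpha> \<in> pos_rats \<rightarrow>\<^sub>E carrier R" and q: "q \<in> pos_rats"
  shows "(delta_function R x \<otimes>\<^bsub>bounded_denom_ring R\<^esub> \<alpha>) q = \<alpha> (q / x)"
proof -
  have qx: "q / x \<in> pos_rats" using x q by (simp add: pos_rats_def)
  have "conv_support R (delta_function R x) \<alpha> q = (if \<alpha> (q / x) = \<zero> then {} else {(x, q / x)})"
    using x q one_not_zero qx
    by (auto simp: conv_support_def delta_function_def pos_rats_def split: if_splits)
  moreover have "\<alpha> (q / x) \<in> carrier R" using \<alpha> qx by auto
  ultimately show ?thesis
    using q x by (simp add: bounded_denom_ring_def delta_function_def)
qed

end

section \<open>Arithmetic functions form a factorial domain\<close>

text \<open>
  The arithmetic functions are the inverse limit of the power series rings in finitely many variables.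
  The level \<open>r\<close> of the tower has \<open>Suc r\<close> variables, so that the ring in no variables is not needed.
\<close>

lemma (in domain) functions_with_denom_1_factorial:
  assumes PS: "\<And>r. factorial_domain (power_series_ring R (Suc r))"
  shows "subcring (functions_with_denom R 1) (bounded_denom_ring R)"
    and "factorial_domain (bounded_denom_ring R\<lparr>carrier := functions_with_denom R 1\<rparr>)"
proof -
  let ?T = "bounded_denom_ring R" and ?K = "functions_with_denom R 1"
  let ?A = "?T\<lparr>carrier := ?K\<rparr>" and ?B = "\<lambda>r. power_series_ring R (Suc r)"
  have PS_cring: "cring (?B r)" for r
    using PS factorial_domain.axioms(1) domain.axioms(1) by blast
  interpret T: cring ?T by (rule bounded_denom_ring_cring[OF PS_cring])
  have sub: "?K \<subseteq> carrier ?T" using in_bounded_denom_ringI[OF _ zero_less_one] by blast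
  have mult: "\<alpha> \<otimes>\<^bsub>?T\<^esub> \<beta> \<in> ?K" if "\<alpha> \<in> ?K" "\<beta> \<in> ?K" for \<alpha> \<beta>
    using mult_functions_with_denom[of 1 \<alpha> 1 \<beta>] that by simp
  show subcring: "subcring ?K ?T"
  proof (intro T.subcringI' T.subringI)
    fix \<alpha> assume \<alpha>: "\<alpha> \<in> ?K"
    have "\<ominus>\<^bsub>?T\<^esub> \<alpha> = (\<lambda>q\<in>pos_rats. \<ominus> \<alpha> q)"
      using \<alpha> sub uminus_with_denom[OF \<alpha>] uminus_add_bounded_denom[OF \<alpha>] by (intro T.minus_equality) auto
    then show "\<ominus>\<^bsub>?T\<^esub> \<alpha> \<in> ?K" using uminus_with_denom[OF \<alpha>] by simp
  qed (use sub mult one_with_denom add_with_denom in auto)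
  interpret A: cring ?A
    using T.subcring_iff[OF sub] subcring by simp
  have truncation_closed: "restrict f (monomials r) \<in> carrier (power_series_ring R r)"
    if "f \<in> carrier (power_series_ring R (Suc r))" for f r
    using truncation_ring_hom that by (rule ring_hom_closed)
  have "local_factorial_tower ?A ?B (\<lambda>r. coefficient_series 1 (Suc r)) (\<lambda>r f. restrict f (monomials (Suc r)))"
  proof (intro local_factorial_tower.intro local_factorial_tower_axioms.intro A.is_cring)
    fix r
    show "factorial_domain (?B r)" by (rule PS)
    show "coefficient_series 1 (Suc r) \<in> ring_hom ?A (?B r)"
      using coefficient_series_mult[of 1 _ 1, unfolded mult_1]
      by (intro ring_hom_memI)
        (simp_all add: coefficient_series_closed coefficient_series_add coefficient_series_one del: One_nat_def)
    show "(\<lambda>f. restrict f (monomials (Suc r))) \<in> ring_hom (?B (Suc r)) (?B r)"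
      by (rule truncation_ring_hom)
    show "restrict (coefficient_series 1 (Suc (Suc r)) \<alpha>) (monomials (Suc r)) = coefficient_series 1 (Suc r) \<alpha>"
      for \<alpha> :: "rat \<Rightarrow> 'a"
      using monomials_mono[of "Suc r" "Suc (Suc r)"] by (auto simp: coefficient_series_def restrict_def)
    show "\<exists>u\<in>carrier (?B (Suc r)). restrict u (monomials (Suc r)) = v" if v: "v \<in> carrier (?B r)" for v
    proof -
      define u where "u = (\<lambda>m\<in>monomials (Suc (Suc r)). if m \<in> monomials (Suc r) then v m else \<zero>)"
      have u: "u \<in> carrier (?B (Suc r))"
        using power_series_closed[OF v] by (auto simp: u_def power_series_ring_def)
      have "restrict u (monomials (Suc r)) = v"
      proof (rule power_series_eqI[OF truncation_closed[OF u] v])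
        show "restrict u (monomials (Suc r)) m = v m" if "m \<in> monomials (Suc r)" for m
          using that monomials_mono[of "Suc r" "Suc (Suc r)" m] by (simp add: u_def)
      qed
      then show ?thesis using u by blast
    qed
    show "u \<in> Units (?B (Suc r))"
      if u: "u \<in> carrier (?B (Suc r))" and "restrict u (monomials (Suc r)) \<in> Units (?B r)" for u
      using that power_series_Units_iff[OF PS_cring u]
        power_series_Units_iff[OF PS_cring truncation_closed[OF u]] by simp
  next
    fix N :: nat and c :: "nat \<Rightarrow> nat multiset \<Rightarrow> 'a"
    assume closed: "\<And>r. N \<le> r \<Longrightarrow> c r \<in> carrier (?B r)"
      and compat: "\<And>r. N \<le> r \<Longrightarrow> restrict (c (Suc r)) (monomials (Suc r)) = c r"
    have stable: "c s m = c r m" if "N \<le> r" "r \<le> s" "m \<in> monomials (Suc r)" for r s m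
      using that(2)
    proof (induction rule: dec_induct)
      case (step n)
      then have "m \<in> monomials (Suc n)" using that(3) monomials_mono[of "Suc r" "Suc n"] by simp
      then show ?case using step compat[of n] that(1) by (metis le_trans restrict_apply')
    qed simp
    \<comment> \<open>The coefficient of \<open>m\<close> in the limit is read off at some level \<open>k m\<close>, not below \<open>N\<close>, where all variables
      of \<open>m\<close> are present; it does not depend on this level.\<close>
    obtain k where k: "\<And>m. N \<le> k m" "\<And>m. m \<in> monomials (Suc (k m))"
      using ex_in_monomials by metis
    define \<alpha> where "\<alpha> = (\<lambda>q\<in>pos_rats. if q \<in> pos_nats
      then let m = (THE m. q = of_nat (monomial_value m)) in c (k m) m else \<zero>)"
    have \<alpha>_value: "\<alpha> (of_nat (monomial_value m)) = c (k m) m" for m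
      using value_div_in_pos_rats[of 1 m] by (auto simp: \<alpha>_def pos_nats_iff)
    have "\<alpha> \<in> ?K"
    proof -
      have "\<alpha> q \<in> carrier R" if "q \<in> pos_rats" for q
      proof (cases "q \<in> pos_nats")
        case True
        then obtain m where "q = of_nat (monomial_value m)" by (auto simp: pos_nats_iff)
        then show ?thesis using \<alpha>_value[of m] power_series_closed[OF closed[OF k(1)] k(2)] by simp
      qed (use that in \<open>simp add: \<alpha>_def\<close>)
      then show ?thesis by (auto simp: functions_with_denom_def \<alpha>_def)
    qed
    moreover have "coefficient_series 1 (Suc r) \<alpha> = c r" if r: "N \<le> r" for r
    proof (rule power_series_eqI)
      fix m assume m: "m \<in> monomials (Suc r)"
      have "c (k m) m = c r m"
        using stable[of r "k m" m] stable[of "k m" r m] k r m by (cases "k m \<le> r") auto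
      then show "coefficient_series 1 (Suc r) \<alpha> m = c r m"
        using m \<alpha>_value by (simp add: coefficient_series_def)
    qed (use coefficient_series_closed[of 1 \<alpha>] \<open>\<alpha> \<in> ?K\<close> closed r in auto)
    ultimately show "\<exists>\<alpha>\<in>carrier ?A. \<forall>r\<ge>N. coefficient_series 1 (Suc r) \<alpha> = c r"
      by auto
  next
    fix \<alpha> \<beta> assume "\<alpha> \<in> carrier ?A" "\<beta> \<in> carrier ?A"
      and "\<And>r. coefficient_series 1 (Suc r) \<alpha> = coefficient_series 1 (Suc r) \<beta>"
    then show "\<alpha> = \<beta>" by (intro functions_with_denom_eqI[of 1]) auto
  qed
  then show "factorial_domain ?A" by (rule local_factorial_tower.factorial_domain_limit)
qed

section \<open>Inverting the positive integers\<close>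

lemma (in domain) delta_function_Unit:
  assumes T: "cring (bounded_denom_ring R)" and d: "0 < d"
  shows "delta_function R (of_nat d) \<in> Units (bounded_denom_ring R)"
proof -
  let ?T = "bounded_denom_ring R" and ?a = "delta_function R (of_nat d)" and ?b = "delta_function R (1 / of_nat d)"
  interpret T: cring ?T by (rule T)
  have a: "?a \<in> functions_with_denom R 1"
    using d by (intro delta_function_with_denom) (simp add: of_nat_in_pos_nats)
  have b: "?b \<in> functions_with_denom R d"
    using d of_nat_in_pos_nats[of 1] by (intro delta_function_with_denom) simp
  have ab: "?a \<in> carrier ?T" "?b \<in> carrier ?T"
    using in_bounded_denom_ringI[OF a zero_less_one] in_bounded_denom_ringI[OF b d] by simp_all
  have "?a \<otimes>\<^bsub>?T\<^esub> ?b = \<one>\<^bsub>?T\<^esub>"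
  proof (rule PiE_ext)
    show "?a \<otimes>\<^bsub>?T\<^esub> ?b \<in> pos_rats \<rightarrow>\<^sub>E carrier R" "\<one>\<^bsub>?T\<^esub> \<in> pos_rats \<rightarrow>\<^sub>E carrier R"
      using T.m_closed[OF ab] T.one_closed
      by (auto simp: carrier_bounded_denom_ring bounded_denom_functions_def)
    fix q assume q: "q \<in> pos_rats"
    have "?b \<in> pos_rats \<rightarrow>\<^sub>E carrier R" using b by (simp add: functions_with_denom_def)
    then have "(?a \<otimes>\<^bsub>?T\<^esub> ?b) q = ?b (q / of_nat d)"
      using d q by (intro delta_function_mult one_not_zero) (simp_all add: pos_rats_def)
    also have "\<dots> = \<one>\<^bsub>?T\<^esub> q"
      using q d by (simp add: one_bounded_denom_ring delta_function_def pos_rats_def)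
    finally show "(?a \<otimes>\<^bsub>?T\<^esub> ?b) q = \<one>\<^bsub>?T\<^esub> q" .
  qed
  then show ?thesis
    using ab T.divides_one by (metis dividesI)
qed

theorem corollary3p7:
  fixes R :: "('a, 'm) ring_scheme"
  assumes "factorial_domain R"
    and "\<And>r. 1 \<le> r \<Longrightarrow> factorial_domain (power_series_ring R r)"
  shows "factorial_domain (bounded_denom_ring R)"
proof -
  interpret domain R using assms(1) by (rule factorial_domain.axioms(1))
  let ?T = "bounded_denom_ring R" and ?K = "functions_with_denom R 1"
  have PS: "factorial_domain (power_series_ring R (Suc r))" for r using assms(2) by simp
  have T: "cring ?T"
    using PS by (intro bounded_denom_ring_cring domain.axioms(1) factorial_domain.axioms(1))
  interpret T: cring ?T by (rule T)
  show ?thesis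
  proof (rule T.factorial_domain_localization)
    show "subcring ?K ?T" "factorial_domain (?T\<lparr>carrier := ?K\<rparr>)"
      using functions_with_denom_1_factorial PS by blast+
    fix \<alpha> assume "\<alpha> \<in> carrier ?T"
    then obtain d where d: "0 < d" and \<alpha>: "\<alpha> \<in> functions_with_denom R d"
      by (rule in_bounded_denom_ringE)
    \<comment> \<open>Multiplication by the indicator function of \<open>d\<close> shifts the argument by \<open>d\<close> and so clears the denominator.\<close>
    let ?s = "delta_function R (of_nat d)"
    have s: "?s \<in> ?K"
      using d by (intro delta_function_with_denom) (simp add: of_nat_in_pos_nats)
    have "?s \<otimes>\<^bsub>?T\<^esub> \<alpha> \<in> functions_with_denom R d"
      using mult_functions_with_denom[OF zero_less_one s d \<alpha>] by simp
    moreover have "q \<in> pos_nats" if "q \<in> pos_rats" "(?s \<otimes>\<^bsub>?T\<^esub> \<alpha>) q \<noteq> \<zero>\<^bsub>R\<^esub>" for q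
    proof -
      have "(?s \<otimes>\<^bsub>?T\<^esub> \<alpha>) q = \<alpha> (q / of_nat d)"
        using d \<alpha> that(1)
        by (intro delta_function_mult one_not_zero) (auto simp: functions_with_denom_def pos_rats_def)
      moreover have "q / of_nat d \<in> pos_rats" using d that(1) by (simp add: pos_rats_def)
      ultimately have "of_nat d * (q / of_nat d) \<in> pos_nats"
        using \<alpha> that(2) unfolding functions_with_denom_def by (simp del: times_divide_eq_right)
      then show ?thesis using d by simp
    qed
    ultimately have "?s \<otimes>\<^bsub>?T\<^esub> \<alpha> \<in> ?K" by (simp add: functions_with_denom_def)
    then show "\<exists>s\<in>?K \<inter> Units ?T. s \<otimes>\<^bsub>?T\<^esub> \<alpha> \<in> ?K"
      using s delta_function_Unit[OF T d] by blast
  qed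
qed

end
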